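(* Let $(\mathfrak X,\tau)$ be a quasi-Polish space with separating sequence $(h_i)_{i=1}^\infty$ and induced map $H:\mathfrak X\to V=\ell^2(\mathbb N)$, and assume that $(\mathfrak X,\tau)$ is $\sigma$-compact. Let $1\le p<\infty$ and let $\mu$ be a Radon probability measure on $\mathfrak X$. Let $\sigma:V\to V$ be continuous, with bounded range, and satisfying the separating property. Let $(e_k)_{k\in\mathbb N}$ be an orthonormal basis of $V$ and let $\Pi_N$ be the orthogonal projection of $V$ onto $\operatorname{span}\{e_1,\dots,e_N\}$, $N\in\mathbb N$. Fix $f\in L^p(\mu)$. Then for any $\varepsilon>0$ there exist $M\in\mathbb N$, $\alpha_m\in\mathbb R$, $\ell_m\in V'$, $A_m\in\mathcal L(V)$, $b_m\in V$ ($m=1,\dots,M$), and an integer $N_\varepsilon$ such that for all integers $N\ge N_\varepsilon$ $$\int_{\mathfrak X}\left|\sum_{m=1}^M\alpha_m\langle\ell_m\circ\Pi_N,\sigma(\Pi_NA_m\Pi_NH(x)+\Pi_Nb_m)\rangle-f(x)\right|^p\mu(dx)<\varepsilon^p .$$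
   Context: Quasi-Polish here means the following (not the notion from descriptive set theory): a topological space $(\mathfrak X,\tau)$ is quasi-Polish if there is a countable family of $\tau$-continuous functions $h_i:\mathfrak X\to[0,1/i]$, $i\in\mathbb N$, $i\ge1$, separating the points of $\mathfrak X$ (for $x_1\ne x_2$ there is $i$ with $h_i(x_1)\ne h_i(x_2)$). Such a family is called a separating sequence. Its induced map is $H:\mathfrak X\to V$, $H(x)=(h_1(x),h_2(x),\dots)$, where $V=\ell^2(\mathbb N)$ is the real Hilbert space of square-summable sequences. A Borel probability measure $\mu$ on $\mathfrak X$ is Radon if for every Borel set $B\subset\mathfrak X$ and $\varepsilon>0$ there is a compact set $K_\varepsilon\subset B$ with $\mu(B\setminus K_\varepsilon)<\varepsilon$. $L^p(\mu)$ is the space of (classes of) real-valued $p$-integrable Borel functions on $\mathfrak X$. $V'$ is the topological dual of $V$ with pairing $\langle\cdot,\cdot\rangle$, and $\mathcal L(V)$ the continuous linear operators on $V$. Separating property of $\sigma:V\to V$: there exist $\psi\in V'\setminus\{0\}$ and $u_+,u_-,u_0\in V$ such that either $u_+\notin\operatorname{span}\{u_0,u_-\}$ or $u_-\notin\operatorname{span}\{u_0,u_+\}$, and such that $\lim_{\lambda\to\infty}\sigma(\lambda v)=u_+$ if $\langle\psi,v\rangle>0$, $\lim_{\lambda\to\infty}\sigma(\lambda v)=u_-$ if $\langle\psi,v\rangle<0$, and $\lim_{\lambda\to\infty}\sigma(\lambda v)=u_0$ if $\langle\psi,v\rangle=0$. *)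

theory Defs
  imports "HOL-Probability.Probability_Measure"
begin

section \<open>The real Hilbert space of square-summable sequences\<close>

typedef ell2 = "{a :: nat \<Rightarrow> real. summable (\<lambda>n. (a n)\<^sup>2)}"
  morphisms coord Abs_ell2
  by (rule exI[of _ "\<lambda>_. 0"]) simp

setup_lifting type_definition_ell2

lemma summable_coord_square: "summable (\<lambda>n. (coord a n)\<^sup>2)"
  using coord[of a] by simp

lemma summable_mult_of_squares:
  fixes a b :: "nat \<Rightarrow> real"
  assumes "summable (\<lambda>n. (a n)\<^sup>2)" "summable (\<lambda>n. (b n)\<^sup>2)"
  shows "summable (\<lambda>n. a n * b n)"
proof (rule summable_comparison_test')
  show "summable (\<lambda>n. (a n)\<^sup>2 + (b n)\<^sup>2)"
    using assms by (rule summable_add)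
  fix n :: nat
  have "2 * (\<bar>a n\<bar> * \<bar>b n\<bar>) \<le> (a n)\<^sup>2 + (b n)\<^sup>2"
    using sum_squares_bound[of "\<bar>a n\<bar>" "\<bar>b n\<bar>"] by (simp add: mult.assoc)
  moreover have "0 \<le> \<bar>a n\<bar> * \<bar>b n\<bar>"
    by simp
  ultimately show "norm (a n * b n) \<le> (a n)\<^sup>2 + (b n)\<^sup>2"
    unfolding real_norm_def abs_mult by linarith
qed

lemma summable_add_square:
  fixes a b :: "nat \<Rightarrow> real"
  assumes "summable (\<lambda>n. (a n)\<^sup>2)" "summable (\<lambda>n. (b n)\<^sup>2)"
  shows "summable (\<lambda>n. (a n + b n)\<^sup>2)"
proof -
  have "summable (\<lambda>n. (a n)\<^sup>2 + (b n)\<^sup>2 + 2 * (a n * b n))"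
    by (intro summable_add summable_mult summable_mult_of_squares assms)
  then show ?thesis
    by (simp add: power2_sum algebra_simps)
qed

instantiation ell2 :: real_vector
begin

lift_definition zero_ell2 :: ell2 is "\<lambda>_. 0" by simp
lift_definition plus_ell2 :: "ell2 \<Rightarrow> ell2 \<Rightarrow> ell2" is "\<lambda>a b n. a n + b n"
  by (rule summable_add_square)
lift_definition uminus_ell2 :: "ell2 \<Rightarrow> ell2" is "\<lambda>a n. - a n" by simp
lift_definition minus_ell2 :: "ell2 \<Rightarrow> ell2 \<Rightarrow> ell2" is "\<lambda>a b n. a n - b n"
  using summable_add_square[of _ "\<lambda>n. - _ n"] by simp
lift_definition scaleR_ell2 :: "real \<Rightarrow> ell2 \<Rightarrow> ell2" is "\<lambda>r a n. r * a n"
  by (simp add: power_mult_distrib summable_mult)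

instance
  by standard (transfer; simp add: algebra_simps fun_eq_iff)+

end

lemma coord_simps [simp]:
  "coord 0 n = 0"
  "coord (a + b) n = coord a n + coord b n"
  "coord (- a) n = - coord a n"
  "coord (a - b) n = coord a n - coord b n"
  "coord (r *\<^sub>R a) n = r * coord a n"
  by (transfer; simp)+

instantiation ell2 :: real_inner
begin

definition inner_ell2 :: "ell2 \<Rightarrow> ell2 \<Rightarrow> real"
  where "inner_ell2 a b = (\<Sum>n. coord a n * coord b n)"
definition norm_ell2 :: "ell2 \<Rightarrow> real"
  where "norm_ell2 a = sqrt (inner a a)"
definition sgn_ell2 :: "ell2 \<Rightarrow> ell2"
  where "sgn_ell2 a = inverse (norm a) *\<^sub>R a"
definition dist_ell2 :: "ell2 \<Rightarrow> ell2 \<Rightarrow> real"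
  where "dist_ell2 a b = norm (a - b)"
definition uniformity_ell2 :: "(ell2 \<times> ell2) filter"
  where "uniformity_ell2 = (INF e\<in>{0<..}. principal {(x, y). dist x y < e})"
definition open_ell2 :: "ell2 set \<Rightarrow> bool"
  where "open_ell2 U \<longleftrightarrow> (\<forall>x\<in>U. \<forall>\<^sub>F (x', y) in uniformity. x' = x \<longrightarrow> y \<in> U)"

instance
proof
  fix a b c :: ell2 and r :: real
  note summable_coord_mult = summable_mult_of_squares[OF summable_coord_square summable_coord_square]
  show "inner a b = inner b a"
    by (simp add: inner_ell2_def mult.commute)
  show "inner (a + b) c = inner a c + inner b c"
    by (simp add: inner_ell2_def distrib_right suminf_add summable_coord_mult)
  show "inner (r *\<^sub>R a) b = r * inner a b"
    by (simp add: inner_ell2_def mult.assoc suminf_mult summable_coord_mult)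
  show "0 \<le> inner a a"
    by (simp add: inner_ell2_def suminf_nonneg summable_coord_mult)
  show "inner a a = 0 \<longleftrightarrow> a = 0"
  proof
    assume "inner a a = 0"
    then have "\<forall>n. coord a n * coord a n = 0"
      unfolding inner_ell2_def using suminf_eq_zero_iff[OF summable_coord_mult[of a a]] by simp
    then have "coord a = coord 0"
      by (simp add: fun_eq_iff)
    then show "a = 0"
      by (simp add: coord_inject)
  qed (simp add: inner_ell2_def)
qed (fact sgn_ell2_def dist_ell2_def uniformity_ell2_def open_ell2_def norm_ell2_def)+

end

lemma norm_ell2_square: "(norm (a :: ell2))\<^sup>2 = (\<Sum>n. (coord a n)\<^sup>2)"
  unfolding power2_norm_eq_inner by (simp add: inner_ell2_def power2_eq_square)

lemma abs_coord_le_norm: "\<bar>coord a n\<bar> \<le> norm a"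
proof -
  have "(\<Sum>k\<in>{n}. (coord a k)\<^sup>2) \<le> (norm a)\<^sup>2"
    unfolding norm_ell2_square by (intro sum_le_suminf summable_coord_square) auto
  then show ?thesis
    by (simp add: abs_le_square_iff[symmetric])
qed

instance ell2 :: banach
proof
  fix X :: "nat \<Rightarrow> ell2"
  assume X: "Cauchy X"
  have "\<exists>l. (\<lambda>m. coord (X m) n) \<longlonglongrightarrow> l" for n
  proof -
    have "Cauchy (\<lambda>m. coord (X m) n)"
    proof (rule metric_CauchyI)
      fix e :: real assume "0 < e"
      then obtain M where "\<forall>i\<ge>M. \<forall>j\<ge>M. dist (X i) (X j) < e"
        using metric_CauchyD[OF X] by blast
      then show "\<exists>M. \<forall>i\<ge>M. \<forall>j\<ge>M. dist (coord (X i) n) (coord (X j) n) < e"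
        using abs_coord_le_norm[of "X _ - X _" n]
        by (metis coord_simps(4) dist_norm dist_real_def order_le_less_trans)
    qed
    then show ?thesis
      by (simp add: Cauchy_convergent_iff convergent_def)
  qed
  then obtain l where l: "\<And>n. (\<lambda>m. coord (X m) n) \<longlonglongrightarrow> l n"
    by metis
  have tail: "\<exists>M. \<forall>i\<ge>M. \<forall>n. (\<Sum>k<n. (coord (X i) k - l k)\<^sup>2) \<le> e\<^sup>2" if "0 < e" for e :: real
  proof -
    obtain M where M: "\<forall>i\<ge>M. \<forall>j\<ge>M. dist (X i) (X j) < e"
      using metric_CauchyD[OF X \<open>0 < e\<close>] by blast
    have "(\<Sum>k<n. (coord (X i) k - l k)\<^sup>2) \<le> e\<^sup>2" if "i \<ge> M" for i n
    proof (rule LIMSEQ_le_const2)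
      show "(\<lambda>j. \<Sum>k<n. (coord (X i) k - coord (X j) k)\<^sup>2) \<longlonglongrightarrow> (\<Sum>k<n. (coord (X i) k - l k)\<^sup>2)"
        by (intro tendsto_intros l)
      have "(\<Sum>k<n. (coord (X i) k - coord (X j) k)\<^sup>2) \<le> e\<^sup>2" if "j \<ge> M" for j
      proof -
        have "(\<Sum>k<n. (coord (X i - X j) k)\<^sup>2) \<le> (norm (X i - X j))\<^sup>2"
          unfolding norm_ell2_square by (intro sum_le_suminf summable_coord_square) auto
        also have "\<dots> \<le> e\<^sup>2"
          using M \<open>i \<ge> M\<close> \<open>j \<ge> M\<close> by (intro power_mono) (auto simp: dist_norm less_imp_le)
        finally show ?thesis by simp
      qed
      then show "\<exists>N. \<forall>j\<ge>N. (\<Sum>k<n. (coord (X i) k - coord (X j) k)\<^sup>2) \<le> e\<^sup>2"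
        by blast
    qed
    then show ?thesis by blast
  qed
  have summ: "summable (\<lambda>k. (coord (X i) k - l k)\<^sup>2)"
    if "\<forall>n. (\<Sum>k<n. (coord (X i) k - l k)\<^sup>2) \<le> e\<^sup>2" for i and e :: real
    by (rule summableI_nonneg_bounded[of _ "e\<^sup>2"]) (use that in auto)
  obtain i0 where "\<forall>n. (\<Sum>k<n. (coord (X i0) k - l k)\<^sup>2) \<le> 1\<^sup>2"
    using tail[of 1] by auto
  then have "summable (\<lambda>k. (coord (X i0) k - l k)\<^sup>2)"
    by (rule summ)
  then have "summable (\<lambda>k. (coord (- X i0) k + (coord (X i0) k - l k))\<^sup>2)"
    by (rule summable_add_square[OF summable_coord_square])
  then have "summable (\<lambda>k. (l k)\<^sup>2)"
    by simp
  then have L: "coord (Abs_ell2 l) = l"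
    by (simp add: Abs_ell2_inverse)
  have "X \<longlonglongrightarrow> Abs_ell2 l"
  proof (rule metric_LIMSEQ_I)
    fix e :: real assume "0 < e"
    then obtain M where M: "\<forall>i\<ge>M. \<forall>n. (\<Sum>k<n. (coord (X i) k - l k)\<^sup>2) \<le> (e / 2)\<^sup>2"
      using tail[of "e / 2"] by auto
    have "dist (X i) (Abs_ell2 l) < e" if "i \<ge> M" for i
    proof -
      have "(norm (X i - Abs_ell2 l))\<^sup>2 \<le> (e / 2)\<^sup>2"
        using M that summ[of i "e / 2"]
        by (auto simp: norm_ell2_square L intro!: suminf_le_const)
      then have "norm (X i - Abs_ell2 l) \<le> e / 2"
        using \<open>0 < e\<close> by (simp add: power2_le_iff_abs_le)
      then show ?thesis
        using \<open>0 < e\<close> by (simp add: dist_norm)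
    qed
    then show "\<exists>M. \<forall>i\<ge>M. dist (X i) (Abs_ell2 l) < e"
      by blast
  qed
  then show "convergent X"
    by (auto simp: convergent_def)
qed

section \<open>Quasi-Polish spaces and Radon probability measures\<close>

text \<open>
  A topological space is quasi-Polish iff it admits a separating sequence. Only the functions
  \<open>h i\<close> with \<open>i \<ge> 1\<close> are relevant; \<open>h 0\<close> is arbitrary.
\<close>

definition separating_sequence :: "(nat \<Rightarrow> 'a::topological_space \<Rightarrow> real) \<Rightarrow> bool"
  where "separating_sequence h \<longleftrightarrow>
    (\<forall>i\<ge>1. continuous_on UNIV (h i) \<and> (\<forall>x. h i x \<in> {0..1 / real i})) \<and>
    (\<forall>x y. x \<noteq> y \<longrightarrow> (\<exists>i\<ge>1. h i x \<noteq> h i y))"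

text \<open>
  Coordinates of \<^typ>\<open>ell2\<close> are numbered from \<open>0\<close>, hence the shift of the index.
\<close>

definition induced_map :: "(nat \<Rightarrow> 'a \<Rightarrow> real) \<Rightarrow> 'a \<Rightarrow> ell2"
  where "induced_map h x = Abs_ell2 (\<lambda>n. h (Suc n) x)"

lemma coord_induced_map:
  assumes "separating_sequence h"
  shows "coord (induced_map h x) n = h (Suc n) x"
proof -
  have "summable (\<lambda>n. (h (Suc n) x)\<^sup>2)"
  proof (rule summable_comparison_test')
    show "summable (\<lambda>n. (inverse (real (Suc n)))\<^sup>2)"
      using inverse_power_summable[of 2, where 'a = real]
        summable_Suc_iff[of "\<lambda>n. (inverse (real n))\<^sup>2"]
      by (simp add: power_inverse del: of_nat_Suc)
    fix n :: nat
    have "h (Suc n) x \<in> {0..1 / real (Suc n)}"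
      using assms unfolding separating_sequence_def by (metis le_add1 plus_1_eq_Suc)
    then have "(h (Suc n) x)\<^sup>2 \<le> (inverse (real (Suc n)))\<^sup>2"
      by (intro power_mono) (auto simp: field_simps)
    then show "norm ((h (Suc n) x)\<^sup>2) \<le> (inverse (real (Suc n)))\<^sup>2"
      by simp
  qed
  then show ?thesis
    by (simp add: induced_map_def Abs_ell2_inverse)
qed

definition sigma_compact :: "'a::topological_space set \<Rightarrow> bool"
  where "sigma_compact S \<longleftrightarrow> (\<exists>K :: nat \<Rightarrow> 'a set. (\<forall>n. compact (K n)) \<and> (\<Union>n. K n) = S)"

text \<open>
  The requirement \<open>K \<in> sets borel\<close> only makes \<open>\<mu> (B - K)\<close> meaningful in an arbitrary topological
  space. It is automatic in Hausdorff spaces, in particular in quasi-Polish ones.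
\<close>

definition radon_probability :: "'a::topological_space measure \<Rightarrow> bool"
  where "radon_probability \<mu> \<longleftrightarrow> prob_space \<mu> \<and> sets \<mu> = sets borel \<and>
    (\<forall>B\<in>sets borel. \<forall>\<epsilon>>0. \<exists>K. compact K \<and> K \<in> sets borel \<and> K \<subseteq> B \<and> measure \<mu> (B - K) < \<epsilon>)"

definition in_Lp :: "real \<Rightarrow> 'a measure \<Rightarrow> ('a \<Rightarrow> real) \<Rightarrow> bool"
  where "in_Lp p \<mu> f \<longleftrightarrow> f \<in> borel_measurable \<mu> \<and> integrable \<mu> (\<lambda>x. \<bar>f x\<bar> powr p)"

section \<open>The separating property, orthonormal bases and orthogonal projections\<close>

definition separating_property :: "('v::real_normed_vector \<Rightarrow> 'v) \<Rightarrow> bool"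
  where "separating_property \<sigma> \<longleftrightarrow> (\<exists>\<psi> :: 'v \<Rightarrow>\<^sub>L real. \<psi> \<noteq> 0 \<and> (\<exists>u_plus u_minus u_zero.
    (u_plus \<notin> span {u_zero, u_minus} \<or> u_minus \<notin> span {u_zero, u_plus}) \<and>
    (\<forall>v. blinfun_apply \<psi> v > 0 \<longrightarrow> ((\<lambda>t::real. \<sigma> (t *\<^sub>R v)) \<longlongrightarrow> u_plus) at_top) \<and>
    (\<forall>v. blinfun_apply \<psi> v < 0 \<longrightarrow> ((\<lambda>t::real. \<sigma> (t *\<^sub>R v)) \<longlongrightarrow> u_minus) at_top) \<and>
    (\<forall>v. blinfun_apply \<psi> v = 0 \<longrightarrow> ((\<lambda>t::real. \<sigma> (t *\<^sub>R v)) \<longlongrightarrow> u_zero) at_top)))"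

text \<open>Basis in the Hilbert space sense (dense span), indexed by the positive integers.\<close>

definition orthonormal_basis :: "(nat \<Rightarrow> 'v::real_inner) \<Rightarrow> bool"
  where "orthonormal_basis e \<longleftrightarrow>
    (\<forall>i\<ge>1. \<forall>j\<ge>1. inner (e i) (e j) = (if i = j then 1 else 0)) \<and>
    closure (span (e ` {1..})) = UNIV"

definition orthogonal_projection :: "'v::real_inner set \<Rightarrow> 'v \<Rightarrow> 'v"
  where "orthogonal_projection S v = (THE w. w \<in> S \<and> (\<forall>s\<in>S. orthogonal (v - w) s))"

definition basis_projection :: "(nat \<Rightarrow> 'v::real_inner) \<Rightarrow> nat \<Rightarrow> 'v \<Rightarrow> 'v"
  where "basis_projection e N = orthogonal_projection (span (e ` {1..N}))"

lemma orthogonal_projection_eqI: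
  assumes "subspace S" "w \<in> S" "\<And>s. s \<in> S \<Longrightarrow> orthogonal (v - w) s"
  shows "orthogonal_projection S v = w"
  unfolding orthogonal_projection_def
proof (rule the_equality)
  fix w' assume w': "w' \<in> S \<and> (\<forall>s\<in>S. orthogonal (v - w') s)"
  then have "w' - w \<in> S"
    using assms by (simp add: subspace_diff)
  then have "inner (v - w) (w' - w) = 0" "inner (v - w') (w' - w) = 0"
    using assms(3) w' by (auto simp: orthogonal_def)
  then have "inner (w' - w) (w' - w) = 0"
    by (simp add: inner_diff_left)
  then show "w' = w"
    by simp
qed (use assms in auto)

lemma basis_projection_eq_sum:
  assumes "orthonormal_basis e"
  shows "basis_projection e N v = (\<Sum>k=1..N. inner v (e k) *\<^sub>R e k)"
  unfolding basis_projection_def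
proof (rule orthogonal_projection_eqI)
  let ?w = "\<Sum>k=1..N. inner v (e k) *\<^sub>R e k"
  show "?w \<in> span (e ` {1..N})"
    by (intro span_sum span_scale span_base) auto
  fix s assume "s \<in> span (e ` {1..N})"
  then show "orthogonal (v - ?w) s"
  proof (rule orthogonal_to_span)
    fix x assume "x \<in> e ` {1..N}"
    then obtain j where j: "j \<in> {1..N}" "x = e j"
      by blast
    have "inner ?w (e j) = (\<Sum>k=1..N. if k = j then inner v (e j) else 0)"
      unfolding inner_sum_left using assms j
      by (intro sum.cong) (auto simp: orthonormal_basis_def)
    then show "orthogonal (v - ?w) x"
      using j by (simp add: orthogonal_def inner_diff_left)
  qed
qed simp

end

theory Submission
  imports Defs
begin

text \<open>
  Choose \<open>w\<close> with \<open>inner w u_plus \<noteq> 0\<close> that annihilates \<open>u_zero\<close> and \<open>u_minus\<close> (or with \<open>u_plus\<close> and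
  \<open>u_minus\<close> exchanged), and \<open>v\<close> with \<open>\<psi> v > 0\<close> (respectively \<open>\<psi> v < 0\<close>). Then
  \<open>\<phi> t = inner w (\<sigma> (t v))\<close> is a bounded scalar sigmoid, and rank-one operators \<open>A\<close> turn the vector
  network into \<open>\<phi> (inner a (H x) + c)\<close>. Rescaling puts the indicators of half-spaces into the
  \<open>L\<^sup>p\<close>-closure; step functions then give \<open>exp (inner a (H x))\<close>. These exponentials span a
  point-separating algebra on the Hilbert cube, so by Stone-Weierstrass the closure contains
  \<open>F \<circ> H\<close> for every continuous \<open>F\<close>, hence indicators of compact sets (which are preimages of
  compact sets under the injective map \<open>H\<close>), hence by the Radon property all of \<open>L\<^sup>p\<close>. For a fixed
  network the projections are removed by dominated convergence, as they converge strongly to the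
  identity and \<open>\<sigma>\<close> is bounded.
\<close>

section \<open>Linear combinations and closures in \<open>L\<^sup>p\<close>\<close>

text \<open>The generators \<open>s m\<close> lie in \<open>S\<close> for every index, also outside
  the range of summation, so that witnesses can be chosen for all \<open>m\<close> at once. The
  clause \<open>M \<ge> 1\<close> matches the form of the final claim.\<close>

definition lin_combs :: "('a \<Rightarrow> real) set \<Rightarrow> ('a \<Rightarrow> real) set"
  where "lin_combs S = {\<lambda>x. \<Sum>m=1..M. \<alpha> m * s m x | (M::nat) \<alpha> s. M \<ge> 1 \<and> (\<forall>m. s m \<in> S)}"

lemma lin_combsI:
  fixes M :: nat
  shows "M \<ge> 1 \<Longrightarrow> (\<And>m. s m \<in> S) \<Longrightarrow> (\<lambda>x. \<Sum>m=1..M. \<alpha> m * s m x) \<in> lin_combs S"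
  unfolding lin_combs_def
  by (intro CollectI exI[of _ M] exI[of _ \<alpha>] exI[of _ s]) simp

lemma lin_combs_base: "s \<in> S \<Longrightarrow> s \<in> lin_combs S"
  using lin_combsI[of 1 "\<lambda>_. s" S "\<lambda>_. 1"] by simp

lemma lin_combs_scale:
  assumes "g \<in> lin_combs S"
  shows "(\<lambda>x. c * g x) \<in> lin_combs S"
proof -
  obtain M :: nat and \<alpha> s where "M \<ge> 1" "\<And>m. s m \<in> S" "g = (\<lambda>x. \<Sum>m=1..M. \<alpha> m * s m x)"
    using assms unfolding lin_combs_def by auto
  then show ?thesis
    using lin_combsI[of M s S "\<lambda>m. c * \<alpha> m"] by (simp add: sum_distrib_left mult.assoc)
qed

lemma lin_combs_add:
  assumes "g \<in> lin_combs S" "g' \<in> lin_combs S"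
  shows "(\<lambda>x. g x + g' x) \<in> lin_combs S"
proof -
  obtain M :: nat and \<alpha> s where g: "M \<ge> 1" "\<And>m. s m \<in> S" "g = (\<lambda>x. \<Sum>m=1..M. \<alpha> m * s m x)"
    using assms(1) unfolding lin_combs_def by auto
  obtain M' :: nat and \<alpha>' s' where g': "\<And>m. s' m \<in> S" "g' = (\<lambda>x. \<Sum>m=1..M'. \<alpha>' m * s' m x)"
    using assms(2) unfolding lin_combs_def by auto
  \<comment> \<open>Concatenation of the two families: indices beyond \<open>M\<close> are shifted
    down by \<open>M\<close>.\<close>
  define t where "t m = (if m \<le> M then s m else s' (m - M))" for m
  define \<beta> where "\<beta> m = (if m \<le> M then \<alpha> m else \<alpha>' (m - M))" for m
  have "g x + g' x = (\<Sum>m=1..M + M'. \<beta> m * t m x)" for x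
  proof -
    have "(\<Sum>m=1..M'. \<alpha>' m * s' m x) = (\<Sum>m=1..M'. \<beta> (m + M) * t (m + M) x)"
      by (intro sum.cong) (auto simp: \<beta>_def t_def)
    also have "\<dots> = (\<Sum>m=M + 1..M + M'. \<beta> m * t m x)"
      using sum.shift_bounds_cl_nat_ivl[of "\<lambda>m. \<beta> m * t m x" 1 M M'] by (simp add: add.commute)
    finally show ?thesis
      using g(1) sum.ub_add_nat[of 1 M "\<lambda>m. \<beta> m * t m x" M']
      unfolding g(3) g'(2) by (simp add: \<beta>_def t_def)
  qed
  moreover have "(\<lambda>x. \<Sum>m=1..M + M'. \<beta> m * t m x) \<in> lin_combs S"
    using g g' by (intro lin_combsI) (auto simp: t_def)
  ultimately show ?thesis
    by (simp add: fun_eq_iff)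
qed

text \<open>Every sum has at least one term, so the induction starts at \<open>M = 1\<close> and no
  separate case for the zero function arises; a single term is covered by \<open>base\<close>
  followed by \<open>scale\<close>.\<close>

lemma lin_combs_induct [consumes 1, case_names base scale add]:
  assumes "g \<in> lin_combs S"
    and base: "\<And>s. s \<in> S \<Longrightarrow> P s"
    and scale: "\<And>c u. P u \<Longrightarrow> P (\<lambda>x. c * u x)"
    and add: "\<And>u v. P u \<Longrightarrow> P v \<Longrightarrow> P (\<lambda>x. u x + v x)"
  shows "P g"
proof -
  obtain M :: nat and \<alpha> s where M: "M \<ge> 1" and s: "\<And>m. s m \<in> S"
    and g: "g = (\<lambda>x. \<Sum>m=1..M. \<alpha> m * s m x)"
    using assms(1) unfolding lin_combs_def by auto
  from M have "P (\<lambda>x. \<Sum>m=1..M. \<alpha> m * s m x)"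
  proof (induction M rule: dec_induct)
    case base
    show ?case using scale[OF assms(2)[OF s]] by simp
  next
    case (step M)
    then show ?case using add[OF step.IH scale[OF base[OF s]]] by simp
  qed
  then show ?thesis by (simp add: g)
qed

text \<open>Bilinearity: induction on the first factor reduces it to a generator, then induction on
  the second does the same. This makes the span of a multiplicatively closed set an algebra, as
  Stone-Weierstrass requires.\<close>

lemma lin_combs_mult:
  assumes S: "\<And>s t. s \<in> S \<Longrightarrow> t \<in> S \<Longrightarrow> (\<lambda>x. s x * t x) \<in> S"
    and g: "g \<in> lin_combs S" and g': "g' \<in> lin_combs S"
  shows "(\<lambda>x. g x * g' x) \<in> lin_combs S"
  using g
proof (induction rule: lin_combs_induct)
  case (base s)
  from g' show ?case
  proof (induction rule: lin_combs_induct)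
    case (base t)
    then show ?case using S[OF \<open>s \<in> S\<close>] by (intro lin_combs_base)
  next
    case (scale c u)
    from lin_combs_scale[OF this, of c] show ?case by (simp add: mult.left_commute)
  next
    case (add u v)
    from lin_combs_add[OF this] show ?case by (simp add: distrib_left)
  qed
next
  case (scale c u)
  from lin_combs_scale[OF this, of c] show ?case by (simp add: mult.assoc)
next
  case (add u v)
  from lin_combs_add[OF this] show ?case by (simp add: distrib_right)
qed

section \<open>The \<open>p\<close>-th mean: quasi-triangle inequality and closure\<close>

lemma powr_abs_add_le:
  fixes a b p :: real
  assumes "p \<ge> 0"
  shows "\<bar>a + b\<bar> powr p \<le> 2 powr p * (\<bar>a\<bar> powr p + \<bar>b\<bar> powr p)"
proof -
  \<comment> \<open>Twice the maximum replaces the Minkowski inequality. This works for every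
    \<open>p \<ge> 0\<close>, and the constant \<open>2 powr p\<close> is harmless for closure
    arguments.\<close>
  have "\<bar>a + b\<bar> powr p \<le> (2 * max \<bar>a\<bar> \<bar>b\<bar>) powr p"
    using assms by (intro powr_mono2) auto
  also have "\<dots> = 2 powr p * max \<bar>a\<bar> \<bar>b\<bar> powr p"
    by (simp add: powr_mult)
  also have "\<dots> \<le> 2 powr p * (\<bar>a\<bar> powr p + \<bar>b\<bar> powr p)"
    by (intro mult_left_mono) (auto simp: max_def)
  finally show ?thesis .
qed

lemma
  fixes u v :: "'a \<Rightarrow> real"
  assumes p: "p \<ge> 0"
    and [measurable]: "u \<in> borel_measurable M" "v \<in> borel_measurable M"
    and u: "integrable M (\<lambda>x. \<bar>u x\<bar> powr p)" and v: "integrable M (\<lambda>x. \<bar>v x\<bar> powr p)"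
  shows integrable_powr_abs_add: "integrable M (\<lambda>x. \<bar>u x + v x\<bar> powr p)"
    and integral_powr_abs_add_le: "(LINT x|M. \<bar>u x + v x\<bar> powr p)
      \<le> 2 powr p * ((LINT x|M. \<bar>u x\<bar> powr p) + (LINT x|M. \<bar>v x\<bar> powr p))"
proof -
  have uv: "integrable M (\<lambda>x. 2 powr p * (\<bar>u x\<bar> powr p + \<bar>v x\<bar> powr p))"
    using u v by simp
  show i: "integrable M (\<lambda>x. \<bar>u x + v x\<bar> powr p)"
    by (rule Bochner_Integration.integrable_bound[OF uv])
      (use powr_abs_add_le[OF p] in \<open>auto intro!: AE_I2 order_trans[OF _ abs_ge_self]\<close>)
  have "(LINT x|M. \<bar>u x + v x\<bar> powr p) \<le> (LINT x|M. 2 powr p * (\<bar>u x\<bar> powr p + \<bar>v x\<bar> powr p))"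
    by (intro integral_mono i uv powr_abs_add_le p)
  then show "(LINT x|M. \<bar>u x + v x\<bar> powr p)
      \<le> 2 powr p * ((LINT x|M. \<bar>u x\<bar> powr p) + (LINT x|M. \<bar>v x\<bar> powr p))"
    using u v by simp
qed

text \<open>The closure is formed on functions instead of classes. Integrability of the difference
  is demanded explicitly because the integral of a non-integrable function is 0 by convention, which
  would make the bound meaningless.\<close>

definition Lp_closure :: "real \<Rightarrow> 'a measure \<Rightarrow> ('a \<Rightarrow> real) set \<Rightarrow> ('a \<Rightarrow> real) set"
  where "Lp_closure p M G = {F \<in> borel_measurable M. \<forall>\<delta>>0. \<exists>g\<in>G \<inter> borel_measurable M.
    integrable M (\<lambda>x. \<bar>g x - F x\<bar> powr p) \<and> (LINT x|M. \<bar>g x - F x\<bar> powr p) < \<delta>}"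

lemma Lp_closure_measurable: "F \<in> Lp_closure p M G \<Longrightarrow> F \<in> borel_measurable M"
  by (simp add: Lp_closure_def)

lemma Lp_closureE:
  assumes "F \<in> Lp_closure p M G" "\<delta> > 0"
  obtains g where "g \<in> G" "g \<in> borel_measurable M" "integrable M (\<lambda>x. \<bar>g x - F x\<bar> powr p)"
    "(LINT x|M. \<bar>g x - F x\<bar> powr p) < \<delta>"
  using assms unfolding Lp_closure_def by blast

lemma Lp_closure_base: "g \<in> G \<Longrightarrow> g \<in> borel_measurable M \<Longrightarrow> g \<in> Lp_closure p M G"
  unfolding Lp_closure_def by (auto intro!: bexI[of _ g])

lemma Lp_closure_closed:
  assumes p: "p \<ge> 0" and [measurable]: "F \<in> borel_measurable M"
    and *: "\<And>\<delta>. \<delta> > 0 \<Longrightarrow> \<exists>F'\<in>Lp_closure p M G.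
      integrable M (\<lambda>x. \<bar>F' x - F x\<bar> powr p) \<and> (LINT x|M. \<bar>F' x - F x\<bar> powr p) < \<delta>"
  shows "F \<in> Lp_closure p M G"
  unfolding Lp_closure_def
proof (intro CollectI conjI allI impI)
  fix \<delta> :: real assume "\<delta> > 0"
  \<comment> \<open>Two errors below \<open>\<eta>\<close>, multiplied by the constant
    \<open>2 powr p\<close> of the quasi-triangle inequality, add up to less than
    \<open>\<delta>\<close>.\<close>
  define \<eta> where "\<eta> = \<delta> / (2 * 2 powr p)"
  have \<eta>: "\<eta> > 0" "2 powr p * (\<eta> + \<eta>) = \<delta>"
    using \<open>\<delta> > 0\<close> by (simp_all add: \<eta>_def)
  obtain F' where F': "F' \<in> Lp_closure p M G" "integrable M (\<lambda>x. \<bar>F' x - F x\<bar> powr p)"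
      "(LINT x|M. \<bar>F' x - F x\<bar> powr p) < \<eta>"
    using *[OF \<eta>(1)] by blast
  obtain g where g: "g \<in> G" "g \<in> borel_measurable M" "integrable M (\<lambda>x. \<bar>g x - F' x\<bar> powr p)"
      "(LINT x|M. \<bar>g x - F' x\<bar> powr p) < \<eta>"
    using Lp_closureE[OF F'(1) \<eta>(1)] .
  note [measurable] = g(2) Lp_closure_measurable[OF F'(1)]
  have eq: "g x - F x = (g x - F' x) + (F' x - F x)" for x
    by simp
  have int: "integrable M (\<lambda>x. \<bar>g x - F x\<bar> powr p)"
    unfolding eq by (intro integrable_powr_abs_add p g F') measurable
  have "(LINT x|M. \<bar>g x - F x\<bar> powr p)
      \<le> 2 powr p * ((LINT x|M. \<bar>g x - F' x\<bar> powr p) + (LINT x|M. \<bar>F' x - F x\<bar> powr p))"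
    unfolding eq by (intro integral_powr_abs_add_le p g F') measurable
  also have "\<dots> < 2 powr p * (\<eta> + \<eta>)"
    using g F' by (intro mult_strict_left_mono add_strict_mono) auto
  finally show "\<exists>g\<in>G \<inter> borel_measurable M.
      integrable M (\<lambda>x. \<bar>g x - F x\<bar> powr p) \<and> (LINT x|M. \<bar>g x - F x\<bar> powr p) < \<delta>"
    using g int \<eta> by blast
qed fact

lemma Lp_closure_add:
  assumes p: "p \<ge> 0" and G: "\<And>g g'. g \<in> G \<Longrightarrow> g' \<in> G \<Longrightarrow> (\<lambda>x. g x + g' x) \<in> G"
    and F: "F \<in> Lp_closure p M G" and F': "F' \<in> Lp_closure p M G"
  shows "(\<lambda>x. F x + F' x) \<in> Lp_closure p M G"
  unfolding Lp_closure_def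
proof (intro CollectI conjI allI impI)
  note [measurable] = Lp_closure_measurable[OF F] Lp_closure_measurable[OF F']
  show "(\<lambda>x. F x + F' x) \<in> borel_measurable M"
    by measurable
  fix \<delta> :: real assume "\<delta> > 0"
  define \<eta> where "\<eta> = \<delta> / (2 * 2 powr p)"
  have \<eta>: "\<eta> > 0" "2 powr p * (\<eta> + \<eta>) = \<delta>"
    using \<open>\<delta> > 0\<close> by (simp_all add: \<eta>_def)
  obtain g where g: "g \<in> G" "g \<in> borel_measurable M" "integrable M (\<lambda>x. \<bar>g x - F x\<bar> powr p)"
      "(LINT x|M. \<bar>g x - F x\<bar> powr p) < \<eta>"
    using Lp_closureE[OF F \<eta>(1)] .
  obtain g' where g': "g' \<in> G" "g' \<in> borel_measurable M" "integrable M (\<lambda>x. \<bar>g' x - F' x\<bar> powr p)"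
      "(LINT x|M. \<bar>g' x - F' x\<bar> powr p) < \<eta>"
    using Lp_closureE[OF F' \<eta>(1)] .
  note [measurable] = g(2) g'(2)
  have eq: "g x + g' x - (F x + F' x) = (g x - F x) + (g' x - F' x)" for x
    by simp
  have int: "integrable M (\<lambda>x. \<bar>g x + g' x - (F x + F' x)\<bar> powr p)"
    unfolding eq by (intro integrable_powr_abs_add p g g') measurable
  have "(LINT x|M. \<bar>g x + g' x - (F x + F' x)\<bar> powr p)
      \<le> 2 powr p * ((LINT x|M. \<bar>g x - F x\<bar> powr p) + (LINT x|M. \<bar>g' x - F' x\<bar> powr p))"
    unfolding eq by (intro integral_powr_abs_add_le p g g') measurable
  also have "\<dots> < 2 powr p * (\<eta> + \<eta>)"
    using g g' by (intro mult_strict_left_mono add_strict_mono) auto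
  finally show "\<exists>g\<in>G \<inter> borel_measurable M. integrable M (\<lambda>x. \<bar>g x - (F x + F' x)\<bar> powr p) \<and>
      (LINT x|M. \<bar>g x - (F x + F' x)\<bar> powr p) < \<delta>"
    using G[OF g(1) g'(1)] int \<eta> by (intro bexI[of _ "\<lambda>x. g x + g' x"]) auto
qed

lemma Lp_closure_scale:
  assumes G: "\<And>g. g \<in> G \<Longrightarrow> (\<lambda>x. c * g x) \<in> G" and F: "F \<in> Lp_closure p M G"
  shows "(\<lambda>x. c * F x) \<in> Lp_closure p M G"
  unfolding Lp_closure_def
proof (intro CollectI conjI allI impI)
  note [measurable] = Lp_closure_measurable[OF F]
  show "(\<lambda>x. c * F x) \<in> borel_measurable M"
    by measurable
  fix \<delta> :: real assume "\<delta> > 0"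
  \<comment> \<open>The summand 1 keeps the denominator positive when \<open>c = 0\<close>.\<close>
  then have "\<delta> / (\<bar>c\<bar> powr p + 1) > 0"
    by (simp add: add_nonneg_pos)
  from Lp_closureE[OF F this]
  obtain g where g: "g \<in> G" "g \<in> borel_measurable M" "integrable M (\<lambda>x. \<bar>g x - F x\<bar> powr p)"
      "(LINT x|M. \<bar>g x - F x\<bar> powr p) < \<delta> / (\<bar>c\<bar> powr p + 1)" .
  note [measurable] = g(2)
  have eq: "\<bar>c * g x - c * F x\<bar> powr p = \<bar>c\<bar> powr p * \<bar>g x - F x\<bar> powr p" for x
    by (simp add: right_diff_distrib[symmetric] abs_mult powr_mult)
  have "0 \<le> (LINT x|M. \<bar>g x - F x\<bar> powr p)"
    by (intro integral_nonneg_AE) simp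
  moreover have "(LINT x|M. \<bar>g x - F x\<bar> powr p) * (\<bar>c\<bar> powr p + 1) < \<delta>"
    using g(4) by (simp add: pos_less_divide_eq add_nonneg_pos)
  ultimately have "\<bar>c\<bar> powr p * (LINT x|M. \<bar>g x - F x\<bar> powr p) < \<delta>"
    unfolding distrib_left mult_1_right mult.commute[of "\<bar>c\<bar> powr p"] by linarith
  then show "\<exists>g\<in>G \<inter> borel_measurable M. integrable M (\<lambda>x. \<bar>g x - c * F x\<bar> powr p) \<and>
      (LINT x|M. \<bar>g x - c * F x\<bar> powr p) < \<delta>"
    using G[OF g(1)] g(3) by (intro bexI[of _ "\<lambda>x. c * g x"]) (auto simp: eq)
qed

text \<open>Dominated convergence gives convergence in the \<open>p\<close>-th mean, and the closure
  is closed under such limits. The bound \<open>w\<close> controls the difference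
  \<open>F n x - f x\<close>, so \<open>f\<close> itself need not be estimated.\<close>

lemma Lp_closure_dominated_limit:
  assumes p: "p > 0" and F: "\<And>n. F n \<in> Lp_closure p M G"
    and lim: "\<And>x. x \<in> space M \<Longrightarrow> (\<lambda>n. F n x) \<longlonglongrightarrow> f x"
    and w: "integrable M (\<lambda>x. w x powr p)" "\<And>n x. x \<in> space M \<Longrightarrow> \<bar>F n x - f x\<bar> \<le> w x"
  shows "f \<in> Lp_closure p M G"
proof (rule Lp_closure_closed)
  note [measurable] = Lp_closure_measurable[OF F]
  show [measurable]: "f \<in> borel_measurable M"
    using lim by (rule borel_measurable_LIMSEQ_real) measurable
  have le: "\<bar>F n x - f x\<bar> powr p \<le> w x powr p" if "x \<in> space M" for n x
    using w(2)[OF that] p by (intro powr_mono2) auto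
  have int: "integrable M (\<lambda>x. \<bar>F n x - f x\<bar> powr p)" for n
    by (rule Bochner_Integration.integrable_bound[OF w(1)]) (use le in \<open>auto intro!: AE_I2\<close>)
  have "(\<lambda>n. LINT x|M. \<bar>F n x - f x\<bar> powr p) \<longlonglongrightarrow> (LINT x|M. 0)"
  proof (rule integral_dominated_convergence[where w = "\<lambda>x. w x powr p"])
    show "AE x in M. (\<lambda>n. \<bar>F n x - f x\<bar> powr p) \<longlonglongrightarrow> 0"
    proof (rule AE_I2)
      fix x assume "x \<in> space M"
      from lim[OF this] have "(\<lambda>n. \<bar>F n x - f x\<bar>) \<longlonglongrightarrow> 0"
        by (intro tendsto_rabs_zero LIM_zero)
      \<comment> \<open>The base tends to 0, so passing to the power relies on
        \<open>p > 0\<close>.\<close>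
      from tendsto_powr'[OF this tendsto_const[of p]]
      show "(\<lambda>n. \<bar>F n x - f x\<bar> powr p) \<longlonglongrightarrow> 0"
        using p by simp
    qed
  qed (use le w in \<open>auto intro!: AE_I2\<close>)
  then have "eventually (\<lambda>n. (LINT x|M. \<bar>F n x - f x\<bar> powr p) < \<delta>) sequentially" if "\<delta> > 0" for \<delta>
    using that by (intro order_tendstoD(2)) auto
  then show "\<exists>F'\<in>Lp_closure p M G.
      integrable M (\<lambda>x. \<bar>F' x - f x\<bar> powr p) \<and> (LINT x|M. \<bar>F' x - f x\<bar> powr p) < \<delta>"
    if "\<delta> > 0" for \<delta>
    using that F int eventually_happens'[OF sequentially_bot] by blast
qed (use p in auto)

lemma (in finite_measure) Lp_closure_bounded_limit:
  assumes "p > 0" "\<And>n. F n \<in> Lp_closure p M G"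
    and "\<And>x. x \<in> space M \<Longrightarrow> (\<lambda>n. F n x) \<longlonglongrightarrow> f x"
    and "\<And>n x. x \<in> space M \<Longrightarrow> \<bar>F n x - f x\<bar> \<le> B"
  shows "f \<in> Lp_closure p M G"
  by (rule Lp_closure_dominated_limit[where w = "\<lambda>_. B", OF assms(1,2,3)]) (use assms(4) in auto)

text \<open>Inner regularity passes from compact to Borel sets, linearity from Borel sets to simple
  functions, and dominated convergence from simple functions to all of \<open>L^p\<close>.\<close>

lemma radon_probability_Lp_closure:
  fixes \<mu> :: "'a::topological_space measure"
  assumes \<mu>: "radon_probability \<mu>" and p: "p > 0" and f: "in_Lp p \<mu> f"
    and add: "\<And>g g'. g \<in> G \<Longrightarrow> g' \<in> G \<Longrightarrow> (\<lambda>x. g x + g' x) \<in> G"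
    and scale: "\<And>c g. g \<in> G \<Longrightarrow> (\<lambda>x. c * g x) \<in> G"
    and K: "\<And>K. compact K \<Longrightarrow> indicator K \<in> Lp_closure p \<mu> G"
  shows "f \<in> Lp_closure p \<mu> G"
proof -
  interpret prob_space \<mu>
    using \<mu> by (simp add: radon_probability_def)
  have sets_\<mu> [measurable_cong]: "sets \<mu> = sets borel"
    using \<mu> by (simp add: radon_probability_def)
  have space_\<mu>: "space \<mu> = UNIV"
    using sets_eq_imp_space_eq[OF sets_\<mu>] by simp
  have B: "indicator B \<in> Lp_closure p \<mu> G" if B: "B \<in> sets borel" for B
  proof (rule Lp_closure_closed)
    fix \<delta> :: real assume "\<delta> > 0"
    then obtain K' where K': "compact K'" "K' \<in> sets borel" "K' \<subseteq> B" "measure \<mu> (B - K') < \<delta>"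
      using \<mu> B unfolding radon_probability_def by blast
    \<comment> \<open>Since \<open>K' \<subseteq> B\<close>, the two indicators differ by 1 exactly
      on \<open>B - K'\<close>, so the error is the measure of that set.\<close>
    have "\<bar>indicator K' x - indicator B x\<bar> powr p = indicator (B - K') x" for x
      using K'(3) p by (auto simp: indicator_def)
    moreover have "B - K' \<in> sets \<mu>"
      using B K' by (simp add: sets_\<mu>)
    ultimately show "\<exists>F'\<in>Lp_closure p \<mu> G. integrable \<mu> (\<lambda>x. \<bar>F' x - indicator B x\<bar> powr p) \<and>
        (LINT x|\<mu>. \<bar>F' x - indicator B x\<bar> powr p) < \<delta>"
      using K' by (intro bexI[OF _ K]) (auto simp: emeasure_eq_measure)
  qed (use B p sets_\<mu> in auto)
  have sum: "(\<lambda>x. \<Sum>i\<in>I. F i x) \<in> Lp_closure p \<mu> G" if "\<And>i. i \<in> I \<Longrightarrow> F i \<in> Lp_closure p \<mu> G"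
    for I :: "real set" and F
    using that
  proof (induction I rule: infinite_finite_induct)
    case (insert i I)
    then show ?case
      using p by (auto intro: Lp_closure_add[OF _ add])
  \<comment> \<open>The indicator of the empty set is the zero function, the value of an empty sum
    and, by convention, of an infinite one.\<close>
  qed (use B[of "{}"] in \<open>auto simp: indicator_def[abs_def]\<close>)
  have simple: "s \<in> Lp_closure p \<mu> G" if s: "simple_function \<mu> s" for s :: "'a \<Rightarrow> real"
  proof -
    have fin: "finite (range s)"
      using simple_functionD(1)[OF s] by (simp add: space_\<mu>)
    have "s = (\<lambda>x. \<Sum>y\<in>range s. y * indicator (s -` {y}) x)"
    proof
      fix x
      have "(\<Sum>y\<in>range s. y * indicator (s -` {y}) x) = (\<Sum>y\<in>range s. if y = s x then y else 0)"
        by (intro sum.cong) (auto simp: indicator_def)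
      then show "s x = (\<Sum>y\<in>range s. y * indicator (s -` {y}) x)"
        using fin by simp
    qed
    moreover have "s -` {y} \<in> sets borel" for y
      using simple_functionD(2)[OF s, of "{y}"] by (simp add: space_\<mu> sets_\<mu>)
    then have "(\<lambda>x. \<Sum>y\<in>range s. y * indicator (s -` {y}) x) \<in> Lp_closure p \<mu> G"
      by (intro sum Lp_closure_scale[OF scale] B)
    ultimately show ?thesis by simp
  qed
  have f': "f \<in> borel_measurable \<mu>" "integrable \<mu> (\<lambda>x. \<bar>f x\<bar> powr p)"
    using f by (auto simp: in_Lp_def)
  \<comment> \<open>Simple functions with
    \<open>\<bar>s i x\<bar> \<le> 2 * \<bar>f x\<bar>\<close>; hence the bound
    \<open>3 * \<bar>f x\<bar>\<close> on the difference below.\<close>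
  obtain s where s: "\<And>i. simple_function \<mu> (s i)" "\<And>x. (\<lambda>i. s i x) \<longlonglongrightarrow> f x"
      "\<And>i x. dist (s i x) 0 \<le> 2 * dist (f x) 0"
    using borel_measurable_implies_sequence_metric[OF f'(1), of 0] by (auto simp: space_\<mu>)
  show ?thesis
  proof (rule Lp_closure_dominated_limit[OF p])
    show "s n \<in> Lp_closure p \<mu> G" for n
      by (rule simple[OF s(1)])
    show "integrable \<mu> (\<lambda>x. (3 * \<bar>f x\<bar>) powr p)"
      using f'(2) by (simp add: powr_mult)
    show "\<bar>s n x - f x\<bar> \<le> 3 * \<bar>f x\<bar>" for n x
      using s(3)[of n x] by (simp add: dist_real_def)
  qed (rule s(2))
qed

section \<open>Density of networks with a scalar sigmoid\<close>

text \<open>The scalar situation left after testing the activation against a fixed vector. The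
  limits at \<open>t = 0\<close> and at \<open>t < 0\<close> agree, so rescaled neurons tend to a
  multiple of the indicator of an open half-space.\<close>

locale bounded_sigmoid_network = finite_measure M for M :: "'a measure" +
  fixes p \<kappa> B R :: real and \<phi> :: "real \<Rightarrow> real" and H :: "'a \<Rightarrow> 'v::real_inner"
  assumes p_pos: "p > 0"
    and \<phi>_measurable [measurable]: "\<phi> \<in> borel_measurable borel"
    and \<phi>_bounded: "\<And>t. \<bar>\<phi> t\<bar> \<le> B"
    and \<kappa>_nonzero: "\<kappa> \<noteq> 0"
    and \<phi>_limit_pos: "\<And>t. t > 0 \<Longrightarrow> (\<lambda>n. \<phi> (real n * t)) \<longlonglongrightarrow> \<kappa>"
    and \<phi>_limit_nonpos: "\<And>t. t \<le> 0 \<Longrightarrow> (\<lambda>n. \<phi> (real n * t)) \<longlonglongrightarrow> 0"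
    and H_measurable [measurable]: "\<And>a. (\<lambda>x. inner a (H x)) \<in> borel_measurable M"
    and H_bounded: "\<And>x. norm (H x) \<le> R"
begin

definition neurons :: "('a \<Rightarrow> real) set"
  where "neurons = {\<lambda>x. \<phi> (inner a (H x) + c) | a c. True}"

abbreviation approximable :: "('a \<Rightarrow> real) set"
  where "approximable \<equiv> Lp_closure p M (lin_combs neurons)"

lemma approximable_neuron: "(\<lambda>x. \<phi> (inner a (H x) + c)) \<in> approximable"
proof (rule Lp_closure_base)
  show "(\<lambda>x. \<phi> (inner a (H x) + c)) \<in> lin_combs neurons"
    unfolding neurons_def by (rule lin_combs_base) blast
qed measurable

lemma approximable_scale: "F \<in> approximable \<Longrightarrow> (\<lambda>x. c * F x) \<in> approximable"
  by (rule Lp_closure_scale[OF lin_combs_scale])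

lemma approximable_add:
  "F \<in> approximable \<Longrightarrow> F' \<in> approximable \<Longrightarrow> (\<lambda>x. F x + F' x) \<in> approximable"
  using p_pos by (intro Lp_closure_add[OF _ lin_combs_add]) auto

lemma approximable_zero: "(\<lambda>_. 0) \<in> approximable"
  using approximable_scale[OF approximable_neuron, of 0] by simp

lemma approximable_diff:
  "F \<in> approximable \<Longrightarrow> F' \<in> approximable \<Longrightarrow> (\<lambda>x. F x - F' x) \<in> approximable"
  using approximable_add[of F "\<lambda>x. - 1 * F' x"] approximable_scale[of F' "- 1"] by simp

lemma approximable_sum:
  "(\<And>i. i \<in> I \<Longrightarrow> F i \<in> approximable) \<Longrightarrow> (\<lambda>x. \<Sum>i\<in>I. F i x) \<in> approximable"
  by (induction I rule: infinite_finite_induct) (auto intro: approximable_zero approximable_add)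

text \<open>The factor \<open>real n\<close> can be absorbed into \<open>a\<close> and
  \<open>c\<close>, so a rescaled neuron is again a neuron; as \<open>n\<close> grows it tends
  boundedly to \<open>\<kappa>\<close> times the indicator.\<close>

lemma approximable_halfspace: "(\<lambda>x. indicator {0<..} (inner a (H x) + c)) \<in> approximable"
proof -
  have "(\<lambda>x. \<kappa> * indicator {0<..} (inner a (H x) + c)) \<in> approximable"
  proof (rule Lp_closure_bounded_limit[OF p_pos])
    show "(\<lambda>x. \<phi> (real n * (inner a (H x) + c))) \<in> approximable" for n
      using approximable_neuron[of "real n *\<^sub>R a" "real n * c"] by (simp add: distrib_left)
    show "(\<lambda>n. \<phi> (real n * (inner a (H x) + c)))
        \<longlonglongrightarrow> \<kappa> * indicator {0<..} (inner a (H x) + c)" for x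
      using \<phi>_limit_pos \<phi>_limit_nonpos by (simp add: indicator_def)
    show "\<bar>\<phi> (real n * (inner a (H x) + c)) - \<kappa> * indicator {0<..} (inner a (H x) + c)\<bar>
        \<le> B + \<bar>\<kappa>\<bar>" for n x
      using \<phi>_bounded[of "real n * (inner a (H x) + c)"] by (auto simp: indicator_def)
  qed
  from approximable_scale[OF this, of "inverse \<kappa>"] show ?thesis
    using \<kappa>_nonzero by (simp add: mult.assoc[symmetric])
qed

lemma approximable_exp: "(\<lambda>x. exp (inner a (H x))) \<in> approximable"
proof -
  \<comment> \<open>An integer bound on \<open>inner a (H x)\<close>, so that
    \<open>Suc n * K\<close> bounds the grid index at mesh \<open>1 / N n\<close>.\<close>
  define K where "K = nat \<lceil>norm a * R\<rceil>"
  have K: "\<bar>inner a (H x)\<bar> \<le> real K" for x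
  proof -
    have "\<bar>inner a (H x)\<bar> \<le> norm a * norm (H x)"
      by (rule Cauchy_Schwarz_ineq2)
    also have "\<dots> \<le> norm a * R"
      by (intro mult_left_mono H_bounded) auto
    also have "\<dots> \<le> real K"
      by (simp add: K_def real_nat_ceiling_ge)
    finally show ?thesis .
  qed
  define N where "N n = real (Suc n)" for n
  have N: "N n > 0" for n
    by (simp add: N_def)
  \<comment> \<open>The half-space with normal \<open>- a\<close> describes
    \<open>N n * t < k\<close> at \<open>t = inner a (H x)\<close>, that is,
    \<open>\<lfloor>N n * t\<rfloor> < k\<close>. The difference of the functions for
    \<open>k + 1\<close> and \<open>k\<close> therefore selects the floor value
    \<open>k\<close>.\<close>
  define below where "below n k x = (indicator {0<..} (inner (- a) (H x) + of_int k / N n) :: real)" for n k x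
  \<comment> \<open>Step function equal to \<open>exp (\<lfloor>N n * t\<rfloor> / N n)\<close> at \<open>t = inner a (H x)\<close>: the sum is finite since \<open>t\<close> is bounded.\<close>
  define F where "F n x = (\<Sum>k\<in>{- int (Suc n * K)..int (Suc n * K)}.
    exp (of_int k / N n) * (below n (k + 1) x - below n k x))" for n x
  have F_eq: "F n x = exp (of_int \<lfloor>N n * inner a (H x)\<rfloor> / N n)" for n x
  proof -
    define t where "t = inner a (H x)"
    have below: "below n k x = (if \<lfloor>N n * t\<rfloor> < k then 1 else 0)" for k
    proof -
      have "0 < inner (- a) (H x) + of_int k / N n \<longleftrightarrow> N n * t < of_int k"
        using N[of n] by (simp add: t_def field_simps)
      then show ?thesis
        by (simp add: below_def indicator_def floor_less_iff)
    qed
    have "\<bar>N n * t\<bar> \<le> N n * real K"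
      using K[of x] N[of n] by (simp add: abs_mult t_def)
    then have "\<bar>N n * t\<bar> \<le> of_int (int (Suc n * K))"
      by (simp add: N_def algebra_simps)
    then have *: "\<lfloor>N n * t\<rfloor> \<in> {- int (Suc n * K)..int (Suc n * K)}"
      unfolding abs_le_iff atLeastAtMost_iff le_floor_iff by (auto simp: floor_le_iff)
    have "F n x = (\<Sum>k\<in>{- int (Suc n * K)..int (Suc n * K)}.
        if k = \<lfloor>N n * t\<rfloor> then exp (of_int k / N n) else 0)"
      unfolding F_def below by (intro sum.cong) auto
    with * show ?thesis
      by (simp add: t_def)
  qed
  have floor_le: "of_int \<lfloor>N n * t\<rfloor> / N n \<le> t" for n t
    using N[of n] by (simp add: divide_le_eq mult.commute)
  show ?thesis
  proof (rule Lp_closure_bounded_limit[OF p_pos])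
    show "F n \<in> approximable" for n
      unfolding F_def below_def
      by (intro approximable_sum approximable_scale approximable_diff approximable_halfspace)
    show "(\<lambda>n. F n x) \<longlonglongrightarrow> exp (inner a (H x))" for x
      unfolding F_eq
    proof (intro tendsto_exp)
      define t where "t = inner a (H x)"
      show "(\<lambda>n. of_int \<lfloor>N n * t\<rfloor> / N n) \<longlonglongrightarrow> t"
      proof (rule tendsto_sandwich)
        \<comment> \<open>Rounding down to the grid costs at most one mesh width.\<close>
        have "t - inverse (real (Suc n)) \<le> of_int \<lfloor>N n * t\<rfloor> / N n" for n
        proof -
          have "t - inverse (real (Suc n)) = (N n * t - 1) / N n"
            using N[of n] by (simp add: N_def[symmetric] field_simps del: of_nat_Suc)
          also have "\<dots> \<le> of_int \<lfloor>N n * t\<rfloor> / N n"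
            using N[of n] by (intro divide_right_mono) linarith+
          finally show ?thesis .
        qed
        then show "\<forall>\<^sub>F n in sequentially. t - inverse (real (Suc n)) \<le> of_int \<lfloor>N n * t\<rfloor> / N n"
          by simp
        show "(\<lambda>n. t - inverse (real (Suc n))) \<longlonglongrightarrow> t"
          using tendsto_diff[OF tendsto_const LIMSEQ_inverse_real_of_nat] by simp
      qed (use floor_le in auto)
    qed
    show "\<bar>F n x - exp (inner a (H x))\<bar> \<le> exp (real K)" for n x
    proof -
      have "F n x \<le> exp (inner a (H x))"
        unfolding F_eq using floor_le by simp
      moreover have "F n x > 0"
        unfolding F_eq by simp
      moreover have "exp (inner a (H x)) \<le> exp (real K)"
        using K[of x] by simp
      ultimately show ?thesis by linarith
    qed
  qed
qed

text \<open>Stone-Weierstrass for the span of the exponentials on \<open>Q\<close>: products of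
  exponentials are exponentials, and \<open>a = 0\<close> gives the constants. Uniform approximation
  on \<open>Q\<close> passes to the \<open>p\<close>-th mean because the measure is finite.\<close>

lemma approximable_continuous:
  assumes Q: "compact Q" "\<And>x. H x \<in> Q" and F: "continuous_on Q F"
  shows "(\<lambda>x. F (H x)) \<in> approximable"
proof -
  define S where "S = range (\<lambda>(a::'v) y. exp (inner a y))"
  have "\<exists>g\<in>lin_combs S. \<forall>y\<in>Q. \<bar>F y - g y\<bar> < \<delta>" if "\<delta> > 0" for \<delta>
  proof -
    have "\<exists>g. g \<in> lin_combs S \<and> (\<forall>y\<in>Q. \<bar>F y - g y\<bar> < \<delta>)"
    proof (rule Stone_Weierstrass_HOL[OF Q(1) _ _ _ _ _ F that])
      have "(\<lambda>_. 1) \<in> S"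
        unfolding S_def by (rule range_eqI[of _ _ 0]) simp
      from lin_combs_scale[OF lin_combs_base[OF this]] show "(\<lambda>_. c) \<in> lin_combs S" for c
        by simp
      show "continuous_on Q g" if "g \<in> lin_combs S" for g
        using that by (induction rule: lin_combs_induct) (auto simp: S_def intro!: continuous_intros)
      have "(\<lambda>x. s x * t x) \<in> S" if st: "s \<in> S" "t \<in> S" for s t
      proof -
        obtain a b where "s = (\<lambda>y. exp (inner a y))" "t = (\<lambda>y. exp (inner b y))"
          using st by (auto simp: S_def)
        then show ?thesis
          unfolding S_def by (intro range_eqI[of _ _ "a + b"]) (simp add: inner_add_left exp_add)
      qed
      then show "(\<lambda>x. g x * g' x) \<in> lin_combs S" if "g \<in> lin_combs S \<and> g' \<in> lin_combs S" for g g'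
        using that by (intro lin_combs_mult) auto
      show "\<exists>g. g \<in> lin_combs S \<and> g y \<noteq> g z" if "y \<in> Q \<and> z \<in> Q \<and> y \<noteq> z" for y z
      proof -
        \<comment> \<open>The vector \<open>y - z\<close> itself separates the points: its inner
          products with \<open>y\<close> and \<open>z\<close> differ by the square of
          \<open>norm (y - z)\<close>.\<close>
        have "inner (y - z) (y - z) \<noteq> 0"
          using that by simp
        then have "exp (inner (y - z) y) \<noteq> exp (inner (y - z) z)"
          by (simp add: inner_diff_right)
        moreover have "(\<lambda>x. exp (inner (y - z) x)) \<in> lin_combs S"
          by (intro lin_combs_base) (simp add: S_def)
        ultimately show ?thesis by blast
      qed
    qed (auto intro: lin_combs_add)
    then show ?thesis by blast
  qed
  from this[of "inverse (real (Suc n))" for n]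
  have "\<forall>n. \<exists>g\<in>lin_combs S. \<forall>y\<in>Q. \<bar>F y - g y\<bar> < inverse (real (Suc n))"
    by simp
  then obtain g where g: "\<And>n. g n \<in> lin_combs S"
      "\<And>n y. y \<in> Q \<Longrightarrow> \<bar>F y - g n y\<bar> < inverse (real (Suc n))"
    by metis
  show ?thesis
  proof (rule Lp_closure_bounded_limit[OF p_pos])
    show "(\<lambda>x. g n (H x)) \<in> approximable" for n
      using g(1)[of n]
      by (induction rule: lin_combs_induct)
        (auto simp: S_def intro: approximable_exp approximable_scale approximable_add)
    show "(\<lambda>n. g n (H x)) \<longlonglongrightarrow> F (H x)" for x
    proof (rule LIM_zero_cancel, rule tendsto_rabs_zero_cancel, rule tendsto_sandwich[OF _ _ tendsto_const])
      show "\<forall>\<^sub>F n in sequentially. \<bar>g n (H x) - F (H x)\<bar> \<le> inverse (real (Suc n))"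
        using g(2)[OF Q(2)] by (auto simp: abs_minus_commute intro!: always_eventually less_imp_le)
    qed (use LIMSEQ_inverse_real_of_nat in auto)
    show "\<bar>g n (H x) - F (H x)\<bar> \<le> 1" for n x
    proof -
      have "inverse (real (Suc n)) \<le> 1"
        by (simp add: inverse_le_1_iff)
      with g(2)[OF Q(2), of x n] show ?thesis
        by linarith
    qed
  qed
qed

text \<open>The indicator of a nonempty closed set is the pointwise limit of continuous tent
  functions of the distance to it. Closedness makes this distance positive off the set.\<close>

lemma approximable_closed_preimage:
  assumes Q: "compact Q" "\<And>x. H x \<in> Q" and C: "closed C"
  shows "(\<lambda>x. indicator C (H x)) \<in> approximable"
proof (cases "C = {}")
  \<comment> \<open>The distance to the empty set is 0 by convention, so the tent functions used
    below would be constantly 1 here.\<close>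
  case True
  then show ?thesis by (simp add: approximable_zero)
next
  case False
  show ?thesis
  proof (rule Lp_closure_bounded_limit[OF p_pos])
    show "(\<lambda>x. max 0 (1 - real n * infdist (H x) C)) \<in> approximable" for n
      by (intro approximable_continuous[OF Q] continuous_intros)
    show "(\<lambda>n. max 0 (1 - real n * infdist (H x) C)) \<longlonglongrightarrow> indicator C (H x)" for x
    proof (cases "H x \<in> C")
      case True
      then show ?thesis by simp
    next
      case False
      then have d: "infdist (H x) C > 0"
        using C \<open>C \<noteq> {}\<close> by (simp add: in_closed_iff_infdist_zero infdist_nonneg less_le)
      obtain n0 :: nat where n0: "real n0 * infdist (H x) C > 1"
        using d reals_Archimedean3 by blast
      have "max 0 (1 - real n * infdist (H x) C) = 0" if "n \<ge> n0" for n
      proof -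
        have "real n0 * infdist (H x) C \<le> real n * infdist (H x) C"
          using that d by (intro mult_right_mono) auto
        with n0 show ?thesis by simp
      qed
      then have "\<forall>\<^sub>F n in sequentially. max 0 (1 - real n * infdist (H x) C) = 0"
        unfolding eventually_sequentially by blast
      then have "(\<lambda>n. max 0 (1 - real n * infdist (H x) C)) \<longlonglongrightarrow> 0"
        by (rule tendsto_eventually)
      with False show ?thesis by simp
    qed
    show "\<bar>max 0 (1 - real n * infdist (H x) C) - indicator C (H x)\<bar> \<le> 1" for n x
      using infdist_nonneg[of "H x" C] by (auto simp: indicator_def max_def)
  qed
qed

end

section \<open>Reduction of the vector-valued activation to a scalar sigmoid\<close>

text \<open>Gram-Schmidt, one vector at a time; it needs no completeness because the span is
  finite-dimensional.\<close>

lemma orthogonal_component_exists: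
  fixes u :: "'v::real_inner"
  assumes "finite S"
  shows "\<exists>w. u - w \<in> span S \<and> (\<forall>b\<in>S. inner w b = 0)"
  using assms
proof (induction S arbitrary: u rule: finite_induct)
  case empty
  then show ?case by (intro exI[of _ u]) simp
next
  case (insert b S)
  obtain b' where b': "b - b' \<in> span S" "\<forall>c\<in>S. inner b' c = 0"
    using insert.IH by blast
  obtain w where w: "u - w \<in> span S" "\<forall>c\<in>S. inner w c = 0"
    using insert.IH by blast
  \<comment> \<open>Removes from \<open>w\<close> its component along \<open>b'\<close>, the part of
    \<open>b\<close> orthogonal to \<open>S\<close>. If \<open>b' = 0\<close>, the quotient is 0 by
    convention and \<open>w' = w\<close>.\<close>
  define r where "r = inner w b' / inner b' b'"
  define w' where "w' = w - r *\<^sub>R b'"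
  have mono: "span S \<subseteq> span (insert b S)"
    by (rule span_mono) blast
  have "b - (b - b') \<in> span (insert b S)"
  proof (rule span_diff)
    show "b \<in> span (insert b S)"
      by (rule span_base) simp
    show "b - b' \<in> span (insert b S)"
      using b'(1) mono by blast
  qed
  then have "b' \<in> span (insert b S)"
    by simp
  then have "(u - w) + r *\<^sub>R b' \<in> span (insert b S)"
    using w(1) mono by (intro span_add span_scale) auto
  then have "u - w' \<in> span (insert b S)"
    by (simp add: w'_def algebra_simps)
  moreover have S: "inner w' c = 0" if "c \<in> S" for c
    using that w b' by (simp add: w'_def inner_diff_left)
  moreover have "inner w' b = 0"
  proof -
    have "orthogonal w' (b - b')"
      using b'(1) by (rule orthogonal_to_span) (use S in \<open>auto simp: orthogonal_def\<close>)
    moreover have "inner w' b' = 0"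
      by (cases "b' = 0") (auto simp: w'_def r_def inner_diff_left)
    ultimately show ?thesis
      by (simp add: orthogonal_def inner_diff_right)
  qed
  ultimately show ?case by blast
qed

text \<open>Take for \<open>w\<close> the component of one limit orthogonal to the other two.
  Pairing with \<open>w\<close> kills those two and sends the first to the square of
  \<open>norm w\<close>, which is nonzero because the first limit lies outside their span.\<close>

lemma separating_property_sigmoid:
  fixes \<sigma> :: "'v::real_inner \<Rightarrow> 'v"
  assumes "separating_property \<sigma>"
  obtains w v and \<kappa> :: real where "\<kappa> \<noteq> 0"
    and "\<And>t. t > 0 \<Longrightarrow> (\<lambda>n. inner w (\<sigma> ((real n * t) *\<^sub>R v))) \<longlonglongrightarrow> \<kappa>"
    and "\<And>t. t \<le> 0 \<Longrightarrow> (\<lambda>n. inner w (\<sigma> ((real n * t) *\<^sub>R v))) \<longlonglongrightarrow> 0"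
proof -
  note result = that
  have *: thesis if u: "u \<notin> span {u0, u'}" and \<psi>: "\<psi> \<noteq> 0"
    and pos: "\<And>v. blinfun_apply \<psi> v > 0 \<Longrightarrow> ((\<lambda>t::real. \<sigma> (t *\<^sub>R v)) \<longlongrightarrow> u) at_top"
    and neg: "\<And>v. blinfun_apply \<psi> v < 0 \<Longrightarrow> ((\<lambda>t::real. \<sigma> (t *\<^sub>R v)) \<longlongrightarrow> u') at_top"
    and zero: "\<And>v. blinfun_apply \<psi> v = 0 \<Longrightarrow> ((\<lambda>t::real. \<sigma> (t *\<^sub>R v)) \<longlongrightarrow> u0) at_top"
    for u u' u0 and \<psi> :: "'v \<Rightarrow>\<^sub>L real"
  proof -
    obtain w where w: "u - w \<in> span {u0, u'}" "inner w u0 = 0" "inner w u' = 0"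
      using orthogonal_component_exists[of "{u0, u'}" u] by auto
    have "orthogonal w (u - w)"
      using w(1) by (rule orthogonal_to_span) (use w in \<open>auto simp: orthogonal_def\<close>)
    then have "inner w u = inner w w"
      by (simp add: orthogonal_def inner_diff_right)
    moreover have "w \<noteq> 0"
      using w(1) u by auto
    ultimately have \<kappa>: "inner w u \<noteq> 0"
      by simp
    obtain v0 where v0: "blinfun_apply \<psi> v0 \<noteq> 0"
      using \<psi> by (metis blinfun_eqI zero_blinfun.rep_eq)
    \<comment> \<open>The scaling by \<open>\<psi> v0\<close> fixes the sign:
      \<open>\<psi> v\<close> is the square of \<open>\<psi> v0\<close>.\<close>
    define v where "v = blinfun_apply \<psi> v0 *\<^sub>R v0"
    have v: "blinfun_apply \<psi> v > 0"
      using v0 by (simp add: v_def blinfun.scaleR_right flip: power2_eq_square)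
    have lim: "(\<lambda>n. inner w (\<sigma> ((real n * t) *\<^sub>R v))) \<longlonglongrightarrow> inner w y"
      if "((\<lambda>s::real. \<sigma> (s *\<^sub>R t *\<^sub>R v)) \<longlongrightarrow> y) at_top" for t y
    proof -
      have "(\<lambda>n. \<sigma> (real n *\<^sub>R t *\<^sub>R v)) \<longlonglongrightarrow> y"
        using that filterlim_real_sequentially by (rule filterlim_compose)
      from tendsto_inner[OF tendsto_const this] show ?thesis
        by simp
    qed
    show thesis
    proof (rule result[OF \<kappa>])
      show "(\<lambda>n. inner w (\<sigma> ((real n * t) *\<^sub>R v))) \<longlonglongrightarrow> inner w u" if "t > 0" for t
        using that v by (intro lim pos) (simp add: blinfun.scaleR_right)
      show "(\<lambda>n. inner w (\<sigma> ((real n * t) *\<^sub>R v))) \<longlonglongrightarrow> 0" if "t \<le> 0" for t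
      proof (cases "t = 0")
        \<comment> \<open>The zero vector lies in the kernel of \<open>\<psi>\<close>, so the limit
          \<open>u0\<close> applies and is annihilated by \<open>w\<close>.\<close>
        case True
        then show ?thesis
          using lim[OF zero, of t] w by (simp add: blinfun.scaleR_right)
      next
        case False
        with that v have "blinfun_apply \<psi> (t *\<^sub>R v) < 0"
          by (simp add: blinfun.scaleR_right mult_less_0_iff)
        then show ?thesis
          using lim[OF neg, of t] w by simp
      qed
    qed
  qed
  obtain \<psi> :: "'v \<Rightarrow>\<^sub>L real" and u u' u0 where \<psi>: "\<psi> \<noteq> 0"
    and u: "u \<notin> span {u0, u'} \<or> u' \<notin> span {u0, u}"
    and lims: "\<And>v. blinfun_apply \<psi> v > 0 \<Longrightarrow> ((\<lambda>t::real. \<sigma> (t *\<^sub>R v)) \<longlongrightarrow> u) at_top"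
      "\<And>v. blinfun_apply \<psi> v < 0 \<Longrightarrow> ((\<lambda>t::real. \<sigma> (t *\<^sub>R v)) \<longlongrightarrow> u') at_top"
      "\<And>v. blinfun_apply \<psi> v = 0 \<Longrightarrow> ((\<lambda>t::real. \<sigma> (t *\<^sub>R v)) \<longlongrightarrow> u0) at_top"
    using assms unfolding separating_property_def by blast
  from u show thesis
  proof
    assume "u \<notin> span {u0, u'}"
    from *[OF this \<psi> lims] show thesis .
  next
    assume "u' \<notin> span {u0, u}"
    \<comment> \<open>Passing to \<open>- \<psi>\<close> exchanges the two open half-spaces and
      thereby the roles of \<open>u\<close> and \<open>u'\<close>.\<close>
    from *[OF this, of "- \<psi>"] \<psi> lims show thesis
      by (simp add: uminus_blinfun.rep_eq)
  qed
qed

section \<open>The Hilbert cube and the induced map\<close>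

text \<open>The square-summable bound \<open>c\<close> makes the series for the squared distance to
  \<open>F x0\<close> converge uniformly by the Weierstrass M-test. Its sum \<open>D\<close> is then
  continuous and vanishes at \<open>x0\<close>.\<close>

lemma continuous_on_ell2I:
  fixes F :: "'b::topological_space \<Rightarrow> ell2"
  assumes cont: "\<And>n. continuous_on S (\<lambda>x. coord (F x) n)"
    and bound: "\<And>x n. x \<in> S \<Longrightarrow> \<bar>coord (F x) n\<bar> \<le> c n" and c: "summable (\<lambda>n. (c n)\<^sup>2)"
  shows "continuous_on S F"
  unfolding continuous_on_def
proof
  fix x0 assume x0: "x0 \<in> S"
  define D where "D x = (\<Sum>n. (coord (F x) n - coord (F x0) n)\<^sup>2)" for x
  have "uniform_limit S (\<lambda>n x. \<Sum>i<n. (coord (F x) i - coord (F x0) i)\<^sup>2) D sequentially"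
    unfolding D_def
  proof (rule Weierstrass_m_test)
    show "norm ((coord (F x) n - coord (F x0) n)\<^sup>2) \<le> 4 * (c n)\<^sup>2" if "x \<in> S" for n x
    proof -
      have "\<bar>coord (F x) n - coord (F x0) n\<bar> \<le> 2 * c n"
        using bound[OF that, of n] bound[OF x0, of n] by linarith
      then have "\<bar>coord (F x) n - coord (F x0) n\<bar>\<^sup>2 \<le> (2 * c n)\<^sup>2"
        by (intro power_mono) auto
      then show ?thesis
        by (simp add: power_mult_distrib)
    qed
    show "summable (\<lambda>n. 4 * (c n)\<^sup>2)"
      using c by (rule summable_mult)
  qed
  then have "continuous_on S D"
    by (rule uniform_limit_theorem[rotated])
      (auto intro!: always_eventually continuous_intros cont)
  then have "(D \<longlongrightarrow> D x0) (at x0 within S)"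
    using x0 by (simp add: continuous_on_def)
  then have "((\<lambda>x. sqrt (D x)) \<longlongrightarrow> sqrt (D x0)) (at x0 within S)"
    by (rule tendsto_real_sqrt)
  moreover have "dist (F x) (F x0) = sqrt (D x)" for x
    using norm_ell2_square[of "F x - F x0"]
    by (simp add: dist_norm D_def flip: real_sqrt_unique)
  moreover have "D x0 = 0"
    by (simp add: D_def)
  ultimately show "(F \<longlongrightarrow> F x0) (at x0 within S)"
    by (subst tendsto_dist_iff) simp
qed

lemma summable_inverse_Suc_square: "summable (\<lambda>n. (1 / real (Suc n))\<^sup>2)"
  using inverse_power_summable[of 2, where 'a = real]
    summable_Suc_iff[of "\<lambda>n. (inverse (real n))\<^sup>2"]
  by (simp add: power_inverse inverse_eq_divide[symmetric] del: of_nat_Suc)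

definition hilbert_cube :: "ell2 set"
  where "hilbert_cube = {a. \<forall>n. coord a n \<in> {0..1 / real (Suc n)}}"

text \<open>By Tychonoff the product \<open>Q\<close> of the intervals is compact in the product
  topology. \<open>Abs_ell2\<close> maps it onto the cube and is norm-continuous by the
  square-summable bound on the coordinates.\<close>

lemma compact_hilbert_cube: "compact hilbert_cube"
proof -
  define Q where "Q = PiE UNIV (\<lambda>n. {0..1 / real (Suc n)})"
  have "compactin (product_topology (\<lambda>_. euclidean) UNIV) Q"
    unfolding Q_def compactin_PiE by simp
  then have Q: "compact Q"
    by (simp add: euclidean_product_topology)
  have bound: "\<bar>y n\<bar> \<le> 1 / real (Suc n)" if "y \<in> Q" for y n
    using that by (auto simp: Q_def PiE_iff simp del: of_nat_Suc)
  \<comment> \<open>\<open>Abs_ell2\<close> is specified only on square-summable sequences; the side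
    lengths of the cube guarantee this.\<close>
  have coord: "coord (Abs_ell2 y) = y" if "y \<in> Q" for y
  proof (rule Abs_ell2_inverse, rule CollectI, rule summable_comparison_test'[OF summable_inverse_Suc_square])
    fix n
    show "norm ((y n)\<^sup>2) \<le> (1 / real (Suc n))\<^sup>2"
      using power_mono[OF bound[OF that, of n], of 2] by simp
  qed
  have "continuous_on Q (\<lambda>y. coord (Abs_ell2 y) n)" for n
    using continuous_on_subset[OF continuous_on_product_coordinates]
    by (rule continuous_on_eq) (auto simp: coord)
  then have "continuous_on Q Abs_ell2"
    by (rule continuous_on_ell2I[OF _ _ summable_inverse_Suc_square]) (simp add: coord bound del: of_nat_Suc)
  then have "compact (Abs_ell2 ` Q)"
    using Q by (rule compact_continuous_image)
  moreover have "Abs_ell2 ` Q = hilbert_cube"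
  proof
    show "Abs_ell2 ` Q \<subseteq> hilbert_cube"
      by (auto simp: hilbert_cube_def coord) (auto simp: Q_def PiE_iff)
    show "hilbert_cube \<subseteq> Abs_ell2 ` Q"
    proof
      fix a assume "a \<in> hilbert_cube"
      then have "coord a \<in> Q"
        by (auto simp: hilbert_cube_def Q_def)
      moreover have "a = Abs_ell2 (coord a)"
        by (simp add: coord_inverse)
      ultimately show "a \<in> Abs_ell2 ` Q"
        by (metis imageI)
    qed
  qed
  ultimately show ?thesis by simp
qed

section \<open>The induced map as a continuous injection into the Hilbert cube\<close>

context
  fixes h :: "nat \<Rightarrow> 'a::topological_space \<Rightarrow> real"
  assumes h: "separating_sequence h"
begin

lemma induced_map_in_hilbert_cube: "induced_map h x \<in> hilbert_cube"
  using h unfolding hilbert_cube_def separating_sequence_def mem_Collect_eq coord_induced_map[OF h]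
  by (metis le_add1 plus_1_eq_Suc)

lemma continuous_on_induced_map: "continuous_on UNIV (induced_map h)"
proof (rule continuous_on_ell2I[OF _ _ summable_inverse_Suc_square])
  show "continuous_on UNIV (\<lambda>x. coord (induced_map h x) n)" for n
    using h by (simp add: coord_induced_map[OF h] separating_sequence_def)
  show "\<bar>coord (induced_map h x) n\<bar> \<le> 1 / real (Suc n)" for x n
    using induced_map_in_hilbert_cube[of x] by (auto simp: hilbert_cube_def simp del: of_nat_Suc)
qed

lemma inj_induced_map: "inj (induced_map h)"
proof (rule injI, rule ccontr)
  fix x y assume eq: "induced_map h x = induced_map h y" and "x \<noteq> y"
  then obtain i where "i \<ge> 1" "h i x \<noteq> h i y"
    using h unfolding separating_sequence_def by blast
  moreover have "h (Suc n) x = h (Suc n) y" for n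
    using coord_induced_map[OF h] eq by metis
  ultimately show False
    by (cases i) auto
qed

end

section \<open>Convergence of the basis projections\<close>

context
  fixes e :: "nat \<Rightarrow> 'v::real_inner"
  assumes e: "orthonormal_basis e"
begin

lemma basis_projection_in_span: "basis_projection e N v \<in> span (e ` {1..N})"
  unfolding basis_projection_eq_sum[OF e] by (intro span_sum span_scale span_base) auto

lemma orthogonal_basis_projection:
  assumes "s \<in> span (e ` {1..N})"
  shows "orthogonal (v - basis_projection e N v) s"
  using assms
proof (rule orthogonal_to_span)
  fix x assume "x \<in> e ` {1..N}"
  then obtain j where j: "j \<in> {1..N}" "x = e j"
    by blast
  have "inner (basis_projection e N v) (e j) = (\<Sum>k=1..N. if k = j then inner v (e j) else 0)"
    unfolding basis_projection_eq_sum[OF e] inner_sum_left using e j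
    by (intro sum.cong) (auto simp: orthonormal_basis_def)
  then show "orthogonal (v - basis_projection e N v) x"
    using j by (simp add: orthogonal_def inner_diff_left)
qed

lemma basis_projection_diff:
  "basis_projection e N (u - v) = basis_projection e N u - basis_projection e N v"
  unfolding basis_projection_eq_sum[OF e]
  by (simp add: inner_diff_left scaleR_diff_left sum_subtractf)

lemma norm_basis_projection_le: "norm (basis_projection e N v) \<le> norm v"
proof -
  let ?w = "basis_projection e N v"
  have "(norm ((v - ?w) + ?w))\<^sup>2 = (norm (v - ?w))\<^sup>2 + (norm ?w)\<^sup>2"
    by (intro norm_add_Pythagorean orthogonal_basis_projection basis_projection_in_span)
  then have "(norm ?w)\<^sup>2 \<le> (norm v)\<^sup>2"
    by simp
  then show ?thesis
    by (rule power2_le_imp_le) simp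
qed

text \<open>Pythagoras for \<open>v - ?w\<close> and \<open>?w - s\<close>, the latter lying in the
  span to which the former is orthogonal.\<close>

lemma basis_projection_best_approximation:
  assumes "s \<in> span (e ` {1..N})"
  shows "norm (v - basis_projection e N v) \<le> norm (v - s)"
proof -
  let ?w = "basis_projection e N v"
  have "(norm ((v - ?w) + (?w - s)))\<^sup>2 = (norm (v - ?w))\<^sup>2 + (norm (?w - s))\<^sup>2"
    by (intro norm_add_Pythagorean orthogonal_basis_projection span_diff basis_projection_in_span assms)
  then have "(norm (v - ?w))\<^sup>2 \<le> (norm (v - s))\<^sup>2"
    by simp
  then show ?thesis
    by (rule power2_le_imp_le) simp
qed

lemma span_initial_segment:
  assumes "s \<in> span (e ` {1..})"
  shows "\<exists>N. s \<in> span (e ` {1..N})"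
  using assms
proof (induction rule: span_induct_alt)
  case base
  then show ?case by (auto intro: span_zero)
next
  case (step c x y)
  then obtain k N where k: "k \<ge> 1" "x = e k" and N: "y \<in> span (e ` {1..N})"
    by auto
  have "x \<in> span (e ` {1..max k N})"
    using k by (intro span_base) auto
  moreover have "y \<in> span (e ` {1..max k N})"
    using N by (rule set_rev_mp) (auto intro!: span_mono)
  ultimately show ?case
    by (auto intro: span_add span_scale)
qed

text \<open>The argument may move with \<open>N\<close>, as happens for the nested projections of a
  network. Density of the span and best approximation settle the fixed point \<open>z\<close>;
  contractivity of the projections absorbs \<open>y N - z\<close>.\<close>

lemma basis_projection_tendsto:
  assumes y: "y \<longlonglongrightarrow> z"
  shows "(\<lambda>N. basis_projection e N (y N)) \<longlonglongrightarrow> z"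
proof -
  have "(\<lambda>N. basis_projection e N z) \<longlonglongrightarrow> z"
  proof (rule metric_LIMSEQ_I)
    fix r :: real assume "r > 0"
    moreover have "z \<in> closure (span (e ` {1..}))"
      using e by (simp add: orthonormal_basis_def)
    ultimately obtain s where s: "s \<in> span (e ` {1..})" "dist s z < r"
      unfolding closure_approachable by blast
    then obtain N0 where N0: "s \<in> span (e ` {1..N0})"
      using span_initial_segment by blast
    have "dist (basis_projection e N z) z < r" if "N \<ge> N0" for N
    proof -
      have "s \<in> span (e ` {1..N})"
        using N0 by (rule set_rev_mp) (use that in \<open>auto intro!: span_mono\<close>)
      from basis_projection_best_approximation[OF this, of z] s(2) show ?thesis
        by (simp add: dist_norm norm_minus_commute)
    qed
    then show "\<exists>N0. \<forall>N\<ge>N0. dist (basis_projection e N z) z < r"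
      by blast
  qed
  moreover have "(\<lambda>N. basis_projection e N (y N - z)) \<longlonglongrightarrow> 0"
  proof (rule Lim_null_comparison)
    show "\<forall>\<^sub>F N in sequentially. norm (basis_projection e N (y N - z)) \<le> norm (y N - z)"
      by (simp add: norm_basis_projection_le)
    show "(\<lambda>N. norm (y N - z)) \<longlonglongrightarrow> 0"
      using y by (intro tendsto_norm_zero LIM_zero)
  qed
  ultimately have "(\<lambda>N. basis_projection e N (y N - z) + basis_projection e N z) \<longlonglongrightarrow> 0 + z"
    by (intro tendsto_add)
  then show ?thesis
    by (simp add: basis_projection_diff)
qed

lemma continuous_on_basis_projection:
  "continuous_on S F \<Longrightarrow> continuous_on S (\<lambda>x. basis_projection e N (F x))"
  unfolding basis_projection_eq_sum[OF e] by (intro continuous_intros)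

end

section \<open>Universal approximation\<close>

theorem proposition4p4:
  fixes h :: "nat \<Rightarrow> 'a::topological_space \<Rightarrow> real"
    and \<mu> :: "'a measure"
    and \<sigma> :: "ell2 \<Rightarrow> ell2"
    and e :: "nat \<Rightarrow> ell2"
    and f :: "'a \<Rightarrow> real"
    and p \<epsilon> :: real
  assumes "separating_sequence h"
    and "sigma_compact (UNIV :: 'a set)"
    and "1 \<le> p"
    and "radon_probability \<mu>"
    and "continuous_on UNIV \<sigma>" and "bounded (range \<sigma>)" and "separating_property \<sigma>"
    and "orthonormal_basis e"
    and "in_Lp p \<mu> f"
    and "\<epsilon> > 0"
  shows "\<exists>(M::nat) (\<alpha> :: nat \<Rightarrow> real) (l :: nat \<Rightarrow> ell2 \<Rightarrow>\<^sub>L real)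
      (A :: nat \<Rightarrow> ell2 \<Rightarrow>\<^sub>L ell2) (b :: nat \<Rightarrow> ell2) (N\<^sub>\<epsilon>::nat). M \<ge> 1 \<and> N\<^sub>\<epsilon> \<ge> 1 \<and>
      (\<forall>N\<ge>N\<^sub>\<epsilon>.
        let H = induced_map h;
            P = basis_projection e N;
            g = (\<lambda>x. \<Sum>m=1..M. \<alpha> m *
              (blinfun_apply (l m) \<circ> P) (\<sigma> (P (blinfun_apply (A m) (P (H x))) + P (b m))))
        in integrable \<mu> (\<lambda>x. \<bar>g x - f x\<bar> powr p) \<and>
           (LINT x|\<mu>. \<bar>g x - f x\<bar> powr p) < \<epsilon> powr p)"
proof -
  interpret prob_space \<mu>
    using assms(4) by (simp add: radon_probability_def)
  have sets_\<mu> [measurable_cong]: "sets \<mu> = sets borel"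
    using assms(4) by (simp add: radon_probability_def)
  have continuous_measurable: "g \<in> borel_measurable \<mu>" if "continuous_on UNIV g" for g :: "'a \<Rightarrow> real"
    using borel_measurable_continuous_onI[OF that] measurable_cong_sets[OF sets_\<mu> refl] by blast
  note f [measurable] = assms(9)[unfolded in_Lp_def, THEN conjunct1]
  note f_int = assms(9)[unfolded in_Lp_def, THEN conjunct2]
  have p: "p > 0" "p \<ge> 0"
    using assms(3) by auto
  define H where "H = induced_map h"
  note H_cont = continuous_on_induced_map[OF assms(1), folded H_def]
  note H_cube = induced_map_in_hilbert_cube[OF assms(1), folded H_def]
  note e = assms(8)
  obtain R where R: "\<And>y. y \<in> hilbert_cube \<Longrightarrow> norm y \<le> R"
    using compact_imp_bounded[OF compact_hilbert_cube] unfolding bounded_iff by blast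
  obtain B where B: "\<And>y. norm (\<sigma> y) \<le> B"
    using assms(6) unfolding bounded_iff by blast
  obtain w v and \<kappa> :: real where sigmoid: "\<kappa> \<noteq> 0"
      "\<And>t. t > 0 \<Longrightarrow> (\<lambda>n. inner w (\<sigma> ((real n * t) *\<^sub>R v))) \<longlonglongrightarrow> \<kappa>"
      "\<And>t. t \<le> 0 \<Longrightarrow> (\<lambda>n. inner w (\<sigma> ((real n * t) *\<^sub>R v))) \<longlonglongrightarrow> 0"
    by (rule separating_property_sigmoid[OF assms(7)]) (rule that)
  interpret bounded_sigmoid_network \<mu> p \<kappa> "norm w * B" R "\<lambda>t. inner w (\<sigma> (t *\<^sub>R v))" H
  proof
    show "(\<lambda>t. inner w (\<sigma> (t *\<^sub>R v))) \<in> borel_measurable borel"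
      by (intro borel_measurable_continuous_onI continuous_intros continuous_on_compose2[OF assms(5)]) auto
    show "\<bar>inner w (\<sigma> (t *\<^sub>R v))\<bar> \<le> norm w * B" for t
      using Cauchy_Schwarz_ineq2[of w "\<sigma> (t *\<^sub>R v)"] mult_left_mono[OF B, of "norm w"]
      by (meson norm_ge_zero order_trans)
    show "(\<lambda>x. inner a (H x)) \<in> borel_measurable \<mu>" for a
      by (intro continuous_measurable continuous_intros H_cont)
  qed (use p sigmoid R H_cube in auto)
  have "f \<in> approximable"
  proof (rule radon_probability_Lp_closure[OF assms(4) p(1) assms(9) lin_combs_add lin_combs_scale])
    fix K :: "'a set" assume "compact K"
    then have "compact (H ` K)"
      by (intro compact_continuous_image continuous_on_subset[OF H_cont]) auto
    then have "(\<lambda>x. indicator (H ` K) (H x)) \<in> approximable"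
      by (intro approximable_closed_preimage[OF compact_hilbert_cube H_cube] compact_imp_closed)
    moreover have "indicator (H ` K) (H x) = (indicator K x :: real)" for x
      using inj_induced_map[OF assms(1)] by (auto simp: indicator_def H_def inj_def)
    ultimately show "indicator K \<in> approximable"
      by simp
  qed
  moreover have "\<epsilon> powr p > 0"
    using assms(10) by simp
  ultimately obtain g where g: "g \<in> lin_combs neurons" "g \<in> borel_measurable \<mu>"
      "integrable \<mu> (\<lambda>x. \<bar>g x - f x\<bar> powr p)" "(LINT x|\<mu>. \<bar>g x - f x\<bar> powr p) < \<epsilon> powr p"
    by (rule Lp_closureE)
  then obtain M :: nat and \<alpha> s where M: "M \<ge> 1" and s: "\<And>m. s m \<in> neurons"
      and g_eq: "g = (\<lambda>x. \<Sum>m=1..M. \<alpha> m * s m x)"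
    unfolding lin_combs_def by auto
  have "\<forall>m. \<exists>a c. s m = (\<lambda>x. inner w (\<sigma> ((inner a (H x) + c) *\<^sub>R v)))"
    using s unfolding neurons_def by blast
  then obtain a c where ac: "\<And>m x. s m x = inner w (\<sigma> ((inner (a m) (H x) + c m) *\<^sub>R v))"
    by metis
  define l where "l = (\<lambda>_::nat. blinfun_inner_right w)"
  \<comment> \<open>Rank-one operators along \<open>v\<close>: \<open>A m\<close> sends
    \<open>y\<close> to \<open>inner (a m) y *\<^sub>R v\<close>, so adding \<open>b m\<close> gives
    the argument \<open>(inner (a m) (H x) + c m) *\<^sub>R v\<close> of the scalar sigmoid.\<close>
  define A where "A m = blinfun_scaleR_left v o\<^sub>L blinfun_inner_right (a m)" for m
  define b where "b m = c m *\<^sub>R v" for m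
  define G where "G N x = (\<Sum>m=1..M. \<alpha> m * (blinfun_apply (l m) \<circ> basis_projection e N)
    (\<sigma> (basis_projection e N (blinfun_apply (A m) (basis_projection e N (H x))) + basis_projection e N (b m))))"
    for N x
  have s_eq: "s m x = blinfun_apply (l m) (\<sigma> (blinfun_apply (A m) (H x) + b m))" for m x
    by (simp add: ac l_def A_def b_def scaleR_add_left)
  have \<sigma>_tendsto: "(\<lambda>N. \<sigma> (y N)) \<longlonglongrightarrow> \<sigma> z" if "y \<longlonglongrightarrow> z" for y z
    using assms(5) that by (auto intro: continuous_on_tendsto_compose)
  have G_lim: "(\<lambda>N. G N x) \<longlonglongrightarrow> g x" for x
    unfolding G_def g_eq s_eq comp_def
    by (intro tendsto_intros basis_projection_tendsto[OF e] \<sigma>_tendsto)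
  \<comment> \<open>A bound uniform in \<open>N\<close> and \<open>x\<close>: projections do not
    increase norms and \<open>B\<close> bounds the range of \<open>\<sigma>\<close>.\<close>
  define D where "D = (\<Sum>m=1..M. \<bar>\<alpha> m\<bar> * (norm w * B))"
  have G_bound: "\<bar>G N x\<bar> \<le> D" for N x
  proof -
    have "\<bar>blinfun_apply (l m) (basis_projection e N (\<sigma> y))\<bar> \<le> norm w * B" for m y
    proof -
      have "\<bar>inner w (basis_projection e N (\<sigma> y))\<bar> \<le> norm w * norm (basis_projection e N (\<sigma> y))"
        by (rule Cauchy_Schwarz_ineq2)
      also have "\<dots> \<le> norm w * B"
        by (intro mult_left_mono order_trans[OF norm_basis_projection_le[OF e] B]) auto
      finally show ?thesis
        by (simp add: l_def)
    qed
    then show ?thesis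
      unfolding G_def D_def
      by (intro order_trans[OF sum_abs] sum_mono) (simp add: abs_mult mult_left_mono)
  qed
  have G_meas [measurable]: "G N \<in> borel_measurable \<mu>" for N
    unfolding G_def comp_def
    by (intro continuous_measurable continuous_intros continuous_on_basis_projection[OF e]
        continuous_on_compose2[OF assms(5)] blinfun.continuous_on H_cont) auto
  note [measurable] = g(2)
  \<comment> \<open>Majorant independent of \<open>N\<close>; its constant part is integrable
    because \<open>\<mu>\<close> is finite.\<close>
  define W where "W x = 2 powr p * (D powr p + \<bar>f x\<bar> powr p)" for x
  have W: "integrable \<mu> W"
    unfolding W_def using f_int by simp
  have G_W: "norm (\<bar>G N x - f x\<bar> powr p) \<le> W x" for N x
  proof -
    have "\<bar>G N x + - f x\<bar> powr p \<le> 2 powr p * (\<bar>G N x\<bar> powr p + \<bar>- f x\<bar> powr p)"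
      by (rule powr_abs_add_le[OF p(2)])
    also have "\<dots> \<le> W x"
      unfolding W_def using G_bound p by (auto intro!: mult_left_mono powr_mono2)
    finally show ?thesis by simp
  qed
  have int: "integrable \<mu> (\<lambda>x. \<bar>G N x - f x\<bar> powr p)" for N
    by (rule Bochner_Integration.integrable_bound[OF W])
      (use G_W in \<open>auto intro!: AE_I2 order_trans[OF _ abs_ge_self]\<close>)
  \<comment> \<open>The limit is the error of the unprojected network \<open>g\<close>, already
    strictly below \<open>\<epsilon> powr p\<close>; the slack yields the same bound for all large
    \<open>N\<close>.\<close>
  have "(\<lambda>N. LINT x|\<mu>. \<bar>G N x - f x\<bar> powr p) \<longlonglongrightarrow> (LINT x|\<mu>. \<bar>g x - f x\<bar> powr p)"
  proof (rule integral_dominated_convergence[OF _ _ W])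
    show "AE x in \<mu>. (\<lambda>N. \<bar>G N x - f x\<bar> powr p) \<longlonglongrightarrow> \<bar>g x - f x\<bar> powr p"
      using p(1) by (auto intro!: AE_I2 tendsto_powr' tendsto_intros G_lim)
  qed (use G_W in auto)
  then have "\<forall>\<^sub>F N in sequentially. (LINT x|\<mu>. \<bar>G N x - f x\<bar> powr p) < \<epsilon> powr p"
    using g(4) by (rule order_tendstoD(2))
  then obtain N0 where "\<And>N. N \<ge> N0 \<Longrightarrow> (LINT x|\<mu>. \<bar>G N x - f x\<bar> powr p) < \<epsilon> powr p"
    unfolding eventually_sequentially by blast
  \<comment> \<open>The maximum with 1 makes the threshold a positive integer.\<close>
  then show ?thesis
    using M int unfolding G_def H_def
    by (intro exI[of _ M] exI[of _ \<alpha>] exI[of _ l] exI[of _ A] exI[of _ b] exI[of _ "max 1 N0"])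
      (simp add: Let_def)
qed

end
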